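(* Let $\alpha>-1$ and let $n\in\mathbb N$ be fixed. As $t\to+\infty$, the recurrence coefficients $\alpha_n(t)$ and $\beta_n(t)$ have the asymptotic expansions $$\begin{aligned}\alpha_n(t)=\;&\sqrt t+\frac{2\alpha+3(2n+1)}{4}+\frac{(2\alpha+2n+1)(2\alpha+6n+3)}{32\sqrt t}\\&-\frac{(2\alpha+2n+1)\left[\alpha(4n+2)+8n^2+8n+3\right]}{64t}+O(t^{-3/2}),\end{aligned}$$ $$\begin{aligned}\beta_n(t)=\;&\frac{n\sqrt t}{2}+\frac{2\alpha n+3n^2}{4}+\frac{3n(2\alpha+2n+1)(2\alpha+2n-1)}{64\sqrt t}\\&-\frac{n^2(2\alpha+2n+1)(2\alpha+2n-1)}{32t}+O(t^{-3/2}).\end{aligned}$$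
   Context: For $\alpha>-1$, $t\ge0$, let $w(x;t,\alpha)=x^\alpha e^{-x-t/x}$ on $(0,\infty)$, and let $P_n(x;t,\alpha)$, $n=0,1,2,\dots$, be the monic orthogonal polynomials of degree $n$ with respect to $w$: $\int_0^\infty P_jP_kw\,dx=h_j\delta_{jk}$, $h_j>0$. The recurrence coefficients $\alpha_n(t)$, $\beta_n(t)$ (depending also on the fixed parameter $\alpha$, with which $\alpha_n$ should not be confused) are defined by $xP_n=P_{n+1}+\alpha_nP_n+\beta_nP_{n-1}$ with $P_0=1$, $\beta_0P_{-1}=0$. $\mathbb N$ denotes the positive integers. *)

theory Defs
  imports
    "HOL-Analysis.Analysis"
    "HOL-Computational_Algebra.Polynomial"
    "HOL-Library.Landau_Symbols"
begin

(* Only the values at x > 0 are relevant. *)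
definition laguerre_weight :: "real \<Rightarrow> real \<Rightarrow> real \<Rightarrow> real" where
  "laguerre_weight \<alpha> t x = x powr \<alpha> * exp (- x - t / x)"

(* The integral is a Lebesgue integral over (0, \<infinity>). For laguerre_weight \<alpha> t with \<alpha> > -1 and t \<ge> 0
   all integrands below are integrable, so the convention that a non-integrable function has
   integral 0 never applies. *)
definition monic_orthogonal_polys :: "(real \<Rightarrow> real) \<Rightarrow> (nat \<Rightarrow> real poly) \<Rightarrow> bool" where
  "monic_orthogonal_polys w P \<longleftrightarrow>
     (\<forall>n. degree (P n) = n \<and> lead_coeff (P n) = 1) \<and>
     (\<exists>h. (\<forall>j. h j > 0) \<and>
          (\<forall>j k. (LBINT x:{0<..}. poly (P j) x * poly (P k) x * w x) = (if j = k then h j else 0)))"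

(* The case n = 0 encodes the convention \<beta>\<^sub>0 P\<^sub>-\<^sub>1 = 0; the value b 0 is irrelevant. *)
definition recurrence_coeffs ::
    "(nat \<Rightarrow> real poly) \<Rightarrow> (nat \<Rightarrow> real) \<Rightarrow> (nat \<Rightarrow> real) \<Rightarrow> bool" where
  "recurrence_coeffs P a b \<longleftrightarrow>
     P 0 = 1 \<and>
     (\<forall>n. [:0, 1:] * P n =
          P (Suc n) + smult (a n) (P n) + (if n = 0 then 0 else smult (b n) (P (n - 1))))"

end

theory Submission
  imports Defs "HOL-Real_Asymp.Real_Asymp"
begin

text \<open>Write \<open>S\<^sub>n = (\<Sum>j<n. \<alpha>\<^sub>j)\<close> and \<open>X\<^sub>n = (\<Sum>j<n. \<alpha>\<^sub>j\<^sup>2 + 2 \<beta>\<^sub>j)\<close>. The moments of the weight satisfy a Pearson recurrence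
  and are differentiable in \<open>t\<close>; this yields the Toda equations
  \<open>t \<alpha>\<^sub>n' = \<alpha>\<^sub>n + \<beta>\<^sub>n - \<beta>\<^sub>n\<^sub>+\<^sub>1\<close>, \<open>t \<beta>\<^sub>n' = \<beta>\<^sub>n (2 + \<alpha>\<^sub>n\<^sub>-\<^sub>1 - \<alpha>\<^sub>n)\<close> and the string equation
  \<open>\<alpha>\<^sub>n\<^sup>2 + \<beta>\<^sub>n + \<beta>\<^sub>n\<^sub>+\<^sub>1 = t + 2 S\<^sub>n + (2n + 2 + \<alpha>) \<alpha>\<^sub>n\<close>, whose derivative along the flow gives a second one,
  \<open>X\<^sub>n + (2n + 1 + \<alpha>) \<beta>\<^sub>n = \<beta>\<^sub>n (\<alpha>\<^sub>n + \<alpha>\<^sub>n\<^sub>-\<^sub>1)\<close>. Eliminating the quantities of higher index leaves the Riccati equation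
  \<open>t \<alpha>\<^sub>n' = \<alpha>\<^sub>n\<^sup>2 - (2n + 1 + \<alpha>) \<alpha>\<^sub>n + 2 \<beta>\<^sub>n - 2 S\<^sub>n - t\<close> and the linear equation
  \<open>t \<beta>\<^sub>n' = \<beta>\<^sub>n (2 \<alpha>\<^sub>n\<^sub>-\<^sub>1 + 1 - 2n - \<alpha>) - X\<^sub>n\<close>.

  Both are exponentially unstable forward in \<open>r = sqrt t\<close>, while the string equation and the positivity of
  \<open>\<alpha>\<^sub>n\<close> and \<open>\<beta>\<^sub>n\<close> bound the solutions polynomially. A solution of at most polynomial growth therefore stays
  close to any approximate one, so by induction on \<open>n\<close> it suffices that the claimed
  expansions solve these equations up to a residual of order \<open>1 / r\<^sup>2\<close>.\<close>

section \<open>Exponentially unstable differential equations\<close>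

text \<open>With \<open>\<bar>E\<bar> \<le> N\<close>, the function \<open>((F r)\<^sup>2 - (N / c)\<^sup>2) * exp (- c * r)\<close> is nondecreasing, and it
  tends to \<open>0\<close> because \<open>F\<close> grows polynomially; hence it is never positive.\<close>

lemma growing_ode_bound_at:
  fixes F G E :: "real \<Rightarrow> real"
  assumes deriv: "\<And>r. r \<ge> r0 \<Longrightarrow> (F has_real_derivative G r * F r + E r) (at r)"
    and G: "\<And>r. r \<ge> r0 \<Longrightarrow> G r \<ge> c" and c: "c > 0"
    and E: "\<And>r. r \<ge> r0 \<Longrightarrow> \<bar>E r\<bar> \<le> N"
    and growth: "F \<in> O(\<lambda>r. r ^ k)"
  shows "\<bar>F r0\<bar> \<le> N / c"
proof -
  define W where "W r = ((F r)\<^sup>2 - (N / c)\<^sup>2) * exp (- c * r)" for r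
  define W' where
    "W' r = (2 * F r * (G r * F r + E r) - c * ((F r)\<^sup>2 - (N / c)\<^sup>2)) * exp (- c * r)" for r
  have W': "(W has_real_derivative W' r) (at r)" if "r \<ge> r0" for r
    unfolding W_def[abs_def] W'_def
    by (rule derivative_eq_intros deriv[OF that] refl | simp)+ (simp add: algebra_simps)
  have pos: "W' r \<ge> 0" if "r \<ge> r0" for r
  proof -
    \<comment> \<open>The weight decays only at rate \<open>c\<close>, whereas
      \<open>F\<^sup>2\<close> grows at rate at least \<open>2 * c\<close> apart from forcing. The
      surplus \<open>c * (F r)\<^sup>2\<close> completes the square with the cross term
      \<open>2 * \<bar>F r\<bar> * N\<close>, and this fixes the threshold
      \<open>N / c\<close>.\<close>
    have "0 \<le> (c * \<bar>F r\<bar> - N)\<^sup>2 / c"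
      using c by simp
    also have "\<dots> = c * (F r)\<^sup>2 - 2 * \<bar>F r\<bar> * N + c * (N / c)\<^sup>2"
      using c by (simp add: power2_diff power_mult_distrib power_divide field_simps power2_eq_square)
    also have "\<dots> \<le> 2 * (G r * (F r)\<^sup>2) + 2 * (F r * E r) - c * ((F r)\<^sup>2 - (N / c)\<^sup>2)"
    proof -
      have "c * (F r)\<^sup>2 \<le> G r * (F r)\<^sup>2"
        using G[OF that] by (simp add: mult_right_mono)
      moreover have "\<bar>F r * E r\<bar> \<le> \<bar>F r\<bar> * N"
        using E[OF that] by (simp add: abs_mult mult_left_mono)
      ultimately show ?thesis by (simp add: algebra_simps)
    qed
    also have "\<dots> = 2 * F r * (G r * F r + E r) - c * ((F r)\<^sup>2 - (N / c)\<^sup>2)"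
      by (simp add: algebra_simps power2_eq_square)
    finally show ?thesis
      by (simp add: W'_def)
  qed
  have mono: "W r0 \<le> W r" if "r \<ge> r0" for r
    using that by (intro DERIV_nonneg_imp_nondecreasing[of r0 r W]) (auto intro!: exI W' pos)
  have "(\<lambda>r. exp (- c * r)) \<in> o(\<lambda>r. 1)"
    using c by real_asymp
  have "W \<in> o(\<lambda>r. 1)"
  proof -
    have "(\<lambda>r. (F r)\<^sup>2) \<in> O(\<lambda>r. (r ^ k)\<^sup>2)"
      using growth by (rule landau_o.big_power)
    then have "(\<lambda>r. (F r)\<^sup>2 * exp (- c * r)) \<in> O(\<lambda>r. (r ^ k)\<^sup>2 * exp (- c * r))"
      by (intro landau_o.big.mult_right)
    also have "(\<lambda>r. (r ^ k)\<^sup>2 * exp (- c * r)) \<in> o(\<lambda>r. 1)"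
      using c by real_asymp
    finally have "(\<lambda>r. (F r)\<^sup>2 * exp (- c * r)) \<in> o(\<lambda>r. 1)" .
    moreover have "(\<lambda>r. (N / c)\<^sup>2 * exp (- c * r)) \<in> o(\<lambda>r. 1)"
      using \<open>(\<lambda>r. exp (- c * r)) \<in> o(\<lambda>r. 1)\<close> c by (cases "N = 0") auto
    ultimately show ?thesis
      unfolding W_def[abs_def] left_diff_distrib by (rule sum_in_smallo)
  qed
  then have "(W \<longlongrightarrow> 0) at_top"
    using smalloD_tendsto by fastforce
  then have "W r0 \<le> 0"
    by (rule tendsto_lowerbound) (auto intro!: eventually_at_top_linorderI[of r0] mono)
  then have "(F r0)\<^sup>2 \<le> (N / c)\<^sup>2"
    by (simp add: W_def mult_le_0_iff)
  moreover have "N \<ge> 0"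
    using E[of r0] by linarith
  ultimately show ?thesis
    using c abs_le_square_iff[of "F r0" "N / c"] by simp
qed

text \<open>The forcing bound \<open>M / r ^ m\<close> decreases, so on all of
  \<open>[r0, \<infinity>)\<close> it is at most its value at \<open>r0\<close>. The pointwise bound
  started at each \<open>r0\<close> therefore passes the decay rate of \<open>E\<close> on to
  \<open>F\<close>, whatever the polynomial degree of the a priori growth.\<close>

lemma growing_ode_bigo:
  fixes F G E :: "real \<Rightarrow> real"
  assumes deriv: "eventually (\<lambda>r. (F has_real_derivative G r * F r + E r) (at r)) at_top"
    and G: "eventually (\<lambda>r. G r \<ge> c) at_top" and c: "c > 0"
    and E: "E \<in> O(\<lambda>r. 1 / r ^ m)"
    and growth: "F \<in> O(\<lambda>r. r ^ k)"
  shows "F \<in> O(\<lambda>r. 1 / r ^ m)"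
proof -
  obtain M where M: "M > 0" "eventually (\<lambda>r. norm (E r) \<le> M * norm (1 / r ^ m)) at_top"
    using E by (elim landau_o.bigE)
  have "eventually (\<lambda>r. (F has_real_derivative G r * F r + E r) (at r) \<and> G r \<ge> c \<and>
          norm (E r) \<le> M * norm (1 / r ^ m)) at_top"
    using deriv G M(2) by eventually_elim auto
  then obtain R where R: "\<And>r. r \<ge> R \<Longrightarrow> (F has_real_derivative G r * F r + E r) (at r) \<and> G r \<ge> c \<and>
          norm (E r) \<le> M * norm (1 / r ^ m)"
    by (auto simp: eventually_at_top_linorder)
  have bound: "norm (F r0) \<le> (M / c) * norm (1 / r0 ^ m)" if r0: "r0 \<ge> max R 1" for r0
  proof -
    have "\<bar>F r0\<bar> \<le> (M / r0 ^ m) / c"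
    proof (rule growing_ode_bound_at[OF _ _ c _ growth])
      fix r assume r: "r \<ge> r0"
      with R[of r] r0 show "(F has_real_derivative G r * F r + E r) (at r)" "G r \<ge> c"
        by auto
      have "\<bar>E r\<bar> \<le> M / r ^ m"
        using R[of r] r r0 by auto
      also have "\<dots> \<le> M / r0 ^ m"
        using M(1) r r0 by (intro divide_left_mono power_mono mult_pos_pos zero_less_power) auto
      finally show "\<bar>E r\<bar> \<le> M / r0 ^ m" .
    qed
    then show ?thesis
      using r0 by (simp add: field_simps)
  qed
  show ?thesis
    by (rule bigoI[where c = "M / c"], rule eventually_at_top_linorderI[of "max R 1"]) (rule bound)
qed

text \<open>This is the shape of what is left of each residual below once the nonnegative powers of
  \<open>r\<close> and the term in \<open>1 / r\<close> have cancelled.\<close>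

lemma inverse_powers_bigo:
  fixes c d e :: real
  shows "(\<lambda>r::real. c / r\<^sup>2 + d / r ^ 3 + e / r ^ 4) \<in> O(\<lambda>r. 1 / r\<^sup>2)"
proof -
  have "(\<lambda>r::real. x / r ^ k) \<in> O(\<lambda>r. 1 / r\<^sup>2)" if "k \<ge> 2" for x k
  proof -
    have "norm (x / r ^ k) \<le> \<bar>x\<bar> * norm (1 / r\<^sup>2)" if "r \<ge> 1" for r :: real
      using power_increasing[OF \<open>k \<ge> 2\<close> that] that
      by (auto simp: divide_simps mult_left_mono)
    then show ?thesis
      by (intro bigoI[where c = "\<bar>x\<bar>"] eventually_at_top_linorderI[of 1])
  qed
  from this[of 2 c] this[of 3 d] this[of 4 e] show ?thesis
    by (intro sum_in_bigo) auto
qed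

section \<open>The truncated expansions in the variable \<open>r = sqrt t\<close>\<close>

text \<open>The final digit is the power of \<open>1 / r\<close> that the coefficient multiplies.
  The index \<nu> is real, so that shifts to \<nu> - 1 and \<nu> + 1 are unrestricted and relations
  between neighbouring coefficients become polynomial identities.\<close>

definition alpha_coeff0 :: "real \<Rightarrow> real \<Rightarrow> real" where
  "alpha_coeff0 \<alpha> \<nu> = (2 * \<alpha> + 3 * (2 * \<nu> + 1)) / 4"
definition alpha_coeff1 :: "real \<Rightarrow> real \<Rightarrow> real" where
  "alpha_coeff1 \<alpha> \<nu> = (2 * \<alpha> + 2 * \<nu> + 1) * (2 * \<alpha> + 6 * \<nu> + 3) / 32"
definition alpha_coeff2 :: "real \<Rightarrow> real \<Rightarrow> real" where
  "alpha_coeff2 \<alpha> \<nu> =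
     - ((2 * \<alpha> + 2 * \<nu> + 1) * (\<alpha> * (4 * \<nu> + 2) + 8 * \<nu>\<^sup>2 + 8 * \<nu> + 3) / 64)"
definition beta_coeff0 :: "real \<Rightarrow> real \<Rightarrow> real" where
  "beta_coeff0 \<alpha> \<nu> = (2 * \<alpha> * \<nu> + 3 * \<nu>\<^sup>2) / 4"
definition beta_coeff1 :: "real \<Rightarrow> real \<Rightarrow> real" where
  "beta_coeff1 \<alpha> \<nu> = 3 * \<nu> * (2 * \<alpha> + 2 * \<nu> + 1) * (2 * \<alpha> + 2 * \<nu> - 1) / 64"
definition beta_coeff2 :: "real \<Rightarrow> real \<Rightarrow> real" where
  "beta_coeff2 \<alpha> \<nu> = - (\<nu>\<^sup>2 * (2 * \<alpha> + 2 * \<nu> + 1) * (2 * \<alpha> + 2 * \<nu> - 1) / 32)"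

definition alpha_approx :: "real \<Rightarrow> real \<Rightarrow> real \<Rightarrow> real" where
  "alpha_approx \<alpha> \<nu> r =
     r + alpha_coeff0 \<alpha> \<nu> + alpha_coeff1 \<alpha> \<nu> / r + alpha_coeff2 \<alpha> \<nu> / r\<^sup>2"
definition beta_approx :: "real \<Rightarrow> real \<Rightarrow> real \<Rightarrow> real" where
  "beta_approx \<alpha> \<nu> r =
     \<nu> / 2 * r + beta_coeff0 \<alpha> \<nu> + beta_coeff1 \<alpha> \<nu> / r + beta_coeff2 \<alpha> \<nu> / r\<^sup>2"

text \<open>The coefficients come from dividing those of the expansion of \<open>b n\<close> by \<open>1 - k/2\<close> at the power
  \<open>r\<^sup>k\<close>, which solves the Toda equation \<open>t S' = S - b n\<close> for \<open>S = (\<Sum>j<n. a j)\<close> with \<open>t = r\<^sup>2\<close>.\<close>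

definition alpha_sum_approx :: "real \<Rightarrow> real \<Rightarrow> real \<Rightarrow> real" where
  "alpha_sum_approx \<alpha> \<nu> r =
     \<nu> * r + beta_coeff0 \<alpha> \<nu> + 2 / 3 * beta_coeff1 \<alpha> \<nu> / r + beta_coeff2 \<alpha> \<nu> / 2 / r\<^sup>2"

text \<open>The truncation of \<open>\<beta>\<^sub>\<nu> (\<alpha>\<^sub>\<nu> + \<alpha>\<^sub>\<nu>\<^sub>-\<^sub>1 - (2\<nu> + 1 + \<alpha>))\<close>.\<close>

definition square_sum_approx :: "real \<Rightarrow> real \<Rightarrow> real \<Rightarrow> real" where
  "square_sum_approx \<alpha> \<nu> r =
     \<nu> * r\<^sup>2
     + (\<nu> / 2 * (alpha_coeff0 \<alpha> \<nu> + alpha_coeff0 \<alpha> (\<nu> - 1) - (2 * \<nu> + 1 + \<alpha>)) + 2 * beta_coeff0 \<alpha> \<nu>) * r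
     + (\<nu> / 2 * (alpha_coeff1 \<alpha> \<nu> + alpha_coeff1 \<alpha> (\<nu> - 1))
        + beta_coeff0 \<alpha> \<nu> * (alpha_coeff0 \<alpha> \<nu> + alpha_coeff0 \<alpha> (\<nu> - 1) - (2 * \<nu> + 1 + \<alpha>))
        + 2 * beta_coeff1 \<alpha> \<nu>)
     + (\<nu> / 2 * (alpha_coeff2 \<alpha> \<nu> + alpha_coeff2 \<alpha> (\<nu> - 1))
        + beta_coeff0 \<alpha> \<nu> * (alpha_coeff1 \<alpha> \<nu> + alpha_coeff1 \<alpha> (\<nu> - 1))
        + beta_coeff1 \<alpha> \<nu> * (alpha_coeff0 \<alpha> \<nu> + alpha_coeff0 \<alpha> (\<nu> - 1) - (2 * \<nu> + 1 + \<alpha>))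
        + 2 * beta_coeff2 \<alpha> \<nu>) / r"

lemmas coeff_defs = alpha_coeff0_def alpha_coeff1_def alpha_coeff2_def
  beta_coeff0_def beta_coeff1_def beta_coeff2_def

lemma approx_0 [simp]:
  "beta_approx \<alpha> 0 = (\<lambda>_. 0)" "alpha_sum_approx \<alpha> 0 = (\<lambda>_. 0)" "square_sum_approx \<alpha> 0 = (\<lambda>_. 0)"
  by (auto simp: beta_approx_def alpha_sum_approx_def square_sum_approx_def beta_coeff0_def
      beta_coeff1_def beta_coeff2_def)

text \<open>The truncated expansions are compatible with summation exactly, coefficient by
  coefficient, so passing from n to n + 1 adds no error here.\<close>

lemma alpha_sum_approx_step:
  "alpha_sum_approx \<alpha> (\<nu> + 1) r = alpha_sum_approx \<alpha> \<nu> r + alpha_approx \<alpha> \<nu> r"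
proof -
  have "beta_coeff0 \<alpha> (\<nu> + 1) = beta_coeff0 \<alpha> \<nu> + alpha_coeff0 \<alpha> \<nu>"
    by (simp add: coeff_defs field_simps power2_eq_square)
  moreover have "2 / 3 * beta_coeff1 \<alpha> (\<nu> + 1) = 2 / 3 * beta_coeff1 \<alpha> \<nu> + alpha_coeff1 \<alpha> \<nu>"
    by (simp add: coeff_defs field_simps power2_eq_square)
  moreover have "beta_coeff2 \<alpha> (\<nu> + 1) / 2 = beta_coeff2 \<alpha> \<nu> / 2 + alpha_coeff2 \<alpha> \<nu>"
    by (simp add: coeff_defs field_simps power2_eq_square)
  ultimately show ?thesis
    unfolding alpha_sum_approx_def alpha_approx_def by (simp add: add_divide_distrib distrib_right)
qed

text \<open>With t = r^2 the operator t d/dt becomes (r/2) d/dr, and the last bracket is the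
  derivative of \<open>alpha_approx\<close>. The expression is thus the residual of the truncations
  in the Riccati equation.\<close>

lemma riccati_residual_bigo:
  "(\<lambda>r. (alpha_approx \<alpha> \<nu> r)\<^sup>2 - (2 * \<nu> + 1 + \<alpha>) * alpha_approx \<alpha> \<nu> r + 2 * beta_approx \<alpha> \<nu> r
        - 2 * alpha_sum_approx \<alpha> \<nu> r - r\<^sup>2
        - r / 2 * (1 - alpha_coeff1 \<alpha> \<nu> / r\<^sup>2 - 2 * alpha_coeff2 \<alpha> \<nu> / r ^ 3)) \<in> O(\<lambda>r. 1 / r\<^sup>2)"
  (is "?f \<in> _")
proof -
  define c where "c = 2 * \<nu> + 1 + \<alpha>"
  define A where "A = alpha_coeff0 \<alpha> \<nu>"
  define B where "B = alpha_coeff1 \<alpha> \<nu>"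
  define C where "C = alpha_coeff2 \<alpha> \<nu>"
  define E where "E = beta_coeff0 \<alpha> \<nu>"
  define F where "F = beta_coeff1 \<alpha> \<nu>"
  define G where "G = beta_coeff2 \<alpha> \<nu>"
  \<comment> \<open>Facts 1, 2 and 3 say that the coefficients of \<open>r\<close>, \<open>1\<close>
    and \<open>1 / r\<close> in the residual vanish.\<close>
  have 1: "2 * A - c - \<nu> - 1 / 2 = 0"
    by (simp add: A_def c_def coeff_defs field_simps)
  have 2: "A\<^sup>2 + 2 * B - c * A = 0"
    by (simp add: A_def B_def c_def coeff_defs field_simps power2_eq_square)
  have 3: "2 * C + 2 * A * B - c * B + 2 / 3 * F + B / 2 = 0"
    by (simp add: A_def B_def C_def F_def c_def coeff_defs field_simps power2_eq_square)
  have "?f r = (B\<^sup>2 + 2 * A * C - c * C + G + C) / r\<^sup>2 + (2 * B * C) / r ^ 3 + C\<^sup>2 / r ^ 4"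
    if "r > 0" for r
  proof -
    \<comment> \<open>Writing \<open>z\<close> for \<open>1 / r\<close> turns the claim into a
      polynomial identity in \<open>r\<close> and \<open>z\<close> modulo \<open>r * z = 1\<close>,
      which rewriting can decide.\<close>
    define z where "z = 1 / r"
    have z: "x / r = x * z" "x / r\<^sup>2 = x * z * z" "x / r ^ 3 = x * z * z * z"
      "x / r ^ 4 = x * z * z * z * z" for x
      by (simp_all add: z_def power2_eq_square power3_eq_cube power4_eq_xxxx)
    have rz: "r * z = 1" "r * (z * x) = x" for x
      using that by (simp_all add: z_def)
    have "?f r = (2 * A - c - \<nu> - 1 / 2) * r + (A\<^sup>2 + 2 * B - c * A)
        + (2 * C + 2 * A * B - c * B + 2 / 3 * F + B / 2) / r
        + ((B\<^sup>2 + 2 * A * C - c * C + G + C) / r\<^sup>2 + (2 * B * C) / r ^ 3 + C\<^sup>2 / r ^ 4)"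
      unfolding alpha_approx_def beta_approx_def alpha_sum_approx_def
        A_def [symmetric] B_def [symmetric] C_def [symmetric] c_def [symmetric]
        E_def [symmetric] F_def [symmetric] G_def [symmetric] z
      by (simp add: algebra_simps power2_eq_square rz)
    then show ?thesis
      unfolding 1 2 3 by simp
  qed
  then have "eventually (\<lambda>r. ?f r = (B\<^sup>2 + 2 * A * C - c * C + G + C) / r\<^sup>2 + (2 * B * C) / r ^ 3 + C\<^sup>2 / r ^ 4) at_top"
    by (intro eventually_at_top_linorderI[of 1]) auto
  then show ?thesis
    using inverse_powers_bigo by (subst landau_o.big.in_cong) 
qed

text \<open>Inserting the definition of \<open>square_sum_approx\<close> restores, up to truncation,
  the factor 2 + alpha_(\<nu>-1) - alpha_\<nu> of the Toda equation for beta. This is why only the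
  differences \<open>A - A'\<close>, \<open>B - B'\<close> and \<open>C - C'\<close> enter the three
  cancellation identities.\<close>

lemma linear_residual_bigo:
  "(\<lambda>r. beta_approx \<alpha> \<nu> r * (1 - 2 * \<nu> - \<alpha> + 2 * alpha_approx \<alpha> (\<nu> - 1) r) - square_sum_approx \<alpha> \<nu> r
        - r / 2 * (\<nu> / 2 - beta_coeff1 \<alpha> \<nu> / r\<^sup>2 - 2 * beta_coeff2 \<alpha> \<nu> / r ^ 3)) \<in> O(\<lambda>r. 1 / r\<^sup>2)"
  (is "?f \<in> _")
proof -
  define K where "K = 1 - 2 * \<nu> - \<alpha>"
  define A where "A = alpha_coeff0 \<alpha> (\<nu> - 1)"
  define B where "B = alpha_coeff1 \<alpha> (\<nu> - 1)"
  define C where "C = alpha_coeff2 \<alpha> (\<nu> - 1)"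
  define A' where "A' = alpha_coeff0 \<alpha> \<nu>"
  define B' where "B' = alpha_coeff1 \<alpha> \<nu>"
  define C' where "C' = alpha_coeff2 \<alpha> \<nu>"
  define E where "E = beta_coeff0 \<alpha> \<nu>"
  define F where "F = beta_coeff1 \<alpha> \<nu>"
  define G where "G = beta_coeff2 \<alpha> \<nu>"
  note defs = A_def B_def C_def A'_def B'_def C'_def E_def F_def G_def K_def
  have 1: "\<nu> / 2 * (A - A' + 2) - \<nu> / 4 = 0"
    by (simp add: defs coeff_defs field_simps power2_eq_square)
  have 2: "\<nu> / 2 * (B - B') + E * (A - A' + 2) = 0"
    by (simp add: defs coeff_defs field_simps power2_eq_square)
  have 3: "\<nu> / 2 * (C - C') + E * (B - B') + F * (A - A' + 2) + F / 2 = 0"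
    by (simp add: defs coeff_defs field_simps power2_eq_square)
  have "?f r = (2 * E * C + 2 * F * B + G * (2 * A + K) + G) / r\<^sup>2
      + (2 * F * C + 2 * G * B) / r ^ 3 + 2 * G * C / r ^ 4"
    if "r > 0" for r
  proof -
    define z where "z = 1 / r"
    have z: "x / r = x * z" "x / r\<^sup>2 = x * z * z" "x / r ^ 3 = x * z * z * z"
      "x / r ^ 4 = x * z * z * z * z" for x
      by (simp_all add: z_def power2_eq_square power3_eq_cube power4_eq_xxxx)
    have rz: "r * z = 1" "r * (z * x) = x" for x
      using that by (simp_all add: z_def)
    have shift: "2 * \<nu> + 1 + \<alpha> = 2 - K"
      by (simp add: K_def)
    have "?f r = (\<nu> / 2 * (A - A' + 2) - \<nu> / 4) * r + (\<nu> / 2 * (B - B') + E * (A - A' + 2))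
        + (\<nu> / 2 * (C - C') + E * (B - B') + F * (A - A' + 2) + F / 2) / r
        + ((2 * E * C + 2 * F * B + G * (2 * A + K) + G) / r\<^sup>2
      + (2 * F * C + 2 * G * B) / r ^ 3 + 2 * G * C / r ^ 4)"
      unfolding alpha_approx_def beta_approx_def square_sum_approx_def shift
        A_def [symmetric] B_def [symmetric] C_def [symmetric] K_def [symmetric]
        A'_def [symmetric] B'_def [symmetric] C'_def [symmetric]
        E_def [symmetric] F_def [symmetric] G_def [symmetric] z
      by (simp add: algebra_simps power2_eq_square rz, simp add: field_simps)
    then show ?thesis
      unfolding 1 2 3 by simp
  qed
  then have "eventually (\<lambda>r. ?f r = (2 * E * C + 2 * F * B + G * (2 * A + K) + G) / r\<^sup>2
      + (2 * F * C + 2 * G * B) / r ^ 3 + 2 * G * C / r ^ 4) at_top"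
    by (intro eventually_at_top_linorderI[of 1]) auto
  then show ?thesis
    using inverse_powers_bigo by (subst landau_o.big.in_cong)
qed

text \<open>\<open>square_sum_approx\<close> is the truncation of a closed form and not a sum, so
  the increment is right only up to order 1/r^2. This order suffices because the square sum enters
  the equation for \<open>v\<close> with a factor \<open>2 / r\<close>.\<close>

lemma square_sum_step_bigo:
  "(\<lambda>r. square_sum_approx \<alpha> \<nu> r + (alpha_approx \<alpha> \<nu> r)\<^sup>2 + 2 * beta_approx \<alpha> \<nu> r
        - square_sum_approx \<alpha> (\<nu> + 1) r) \<in> O(\<lambda>r. 1 / r\<^sup>2)"
  (is "?f \<in> _")
proof -
  define c where "c = 2 * \<nu> + 1 + \<alpha>"
  define A where "A = alpha_coeff0 \<alpha> (\<nu> - 1)"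
  define B where "B = alpha_coeff1 \<alpha> (\<nu> - 1)"
  define C where "C = alpha_coeff2 \<alpha> (\<nu> - 1)"
  define A' where "A' = alpha_coeff0 \<alpha> \<nu>"
  define B' where "B' = alpha_coeff1 \<alpha> \<nu>"
  define C' where "C' = alpha_coeff2 \<alpha> \<nu>"
  define A'' where "A'' = alpha_coeff0 \<alpha> (\<nu> + 1)"
  define B'' where "B'' = alpha_coeff1 \<alpha> (\<nu> + 1)"
  define C'' where "C'' = alpha_coeff2 \<alpha> (\<nu> + 1)"
  define E where "E = beta_coeff0 \<alpha> \<nu>"
  define F where "F = beta_coeff1 \<alpha> \<nu>"
  define G where "G = beta_coeff2 \<alpha> \<nu>"
  define E' where "E' = beta_coeff0 \<alpha> (\<nu> + 1)"
  define F' where "F' = beta_coeff1 \<alpha> (\<nu> + 1)"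
  define G' where "G' = beta_coeff2 \<alpha> (\<nu> + 1)"
  note defs = A_def B_def C_def A'_def B'_def C'_def A''_def B''_def C''_def
    E_def F_def G_def E'_def F'_def G'_def c_def
  have 1: "\<nu> / 2 * (A' + A - c) + 2 * E + 2 * A' + \<nu> - ((\<nu> + 1) / 2 * (A'' + A' - (c + 2)) + 2 * E') = 0"
    by (simp add: defs coeff_defs field_simps power2_eq_square)
  have 2: "\<nu> / 2 * (B' + B) + E * (A' + A - c) + 2 * F + (A'\<^sup>2 + 2 * B') + 2 * E
      - ((\<nu> + 1) / 2 * (B'' + B') + E' * (A'' + A' - (c + 2)) + 2 * F') = 0"
    by (simp add: defs coeff_defs field_simps power2_eq_square)
  have 3: "\<nu> / 2 * (C' + C) + E * (B' + B) + F * (A' + A - c) + 2 * G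
      + (2 * C' + 2 * A' * B') + 2 * F
      - ((\<nu> + 1) / 2 * (C'' + C') + E' * (B'' + B') + F' * (A'' + A' - (c + 2)) + 2 * G') = 0"
    by (simp add: defs coeff_defs field_simps power2_eq_square)
  have "?f r = (B'\<^sup>2 + 2 * A' * C' + 2 * G) / r\<^sup>2 + 2 * B' * C' / r ^ 3 + C'\<^sup>2 / r ^ 4"
    if "r > 0" for r
  proof -
    define z where "z = 1 / r"
    have z: "x / r = x * z" "x / r\<^sup>2 = x * z * z" "x / r ^ 3 = x * z * z * z"
      "x / r ^ 4 = x * z * z * z * z" for x
      by (simp_all add: z_def power2_eq_square power3_eq_cube power4_eq_xxxx)
    have rz: "r * z = 1" "r * (z * x) = x" for x
      using that by (simp_all add: z_def)
    have shift: "\<nu> + 1 - 1 = \<nu>" "2 * (\<nu> + 1) + 1 + \<alpha> = c + 2"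
      by (simp_all add: c_def)
    have "?f r =
        (\<nu> / 2 * (A' + A - c) + 2 * E + 2 * A' + \<nu> - ((\<nu> + 1) / 2 * (A'' + A' - (c + 2)) + 2 * E')) * r
        + (\<nu> / 2 * (B' + B) + E * (A' + A - c) + 2 * F + (A'\<^sup>2 + 2 * B') + 2 * E
      - ((\<nu> + 1) / 2 * (B'' + B') + E' * (A'' + A' - (c + 2)) + 2 * F'))
        + (\<nu> / 2 * (C' + C) + E * (B' + B) + F * (A' + A - c) + 2 * G
      + (2 * C' + 2 * A' * B') + 2 * F
      - ((\<nu> + 1) / 2 * (C'' + C') + E' * (B'' + B') + F' * (A'' + A' - (c + 2)) + 2 * G')) / r
        + ((B'\<^sup>2 + 2 * A' * C' + 2 * G) / r\<^sup>2 + 2 * B' * C' / r ^ 3 + C'\<^sup>2 / r ^ 4)"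
      unfolding alpha_approx_def beta_approx_def square_sum_approx_def
        shift
        A_def [symmetric] B_def [symmetric] C_def [symmetric] c_def [symmetric]
        A'_def [symmetric] B'_def [symmetric] C'_def [symmetric]
        A''_def [symmetric] B''_def [symmetric] C''_def [symmetric]
        E_def [symmetric] F_def [symmetric] G_def [symmetric]
        E'_def [symmetric] F'_def [symmetric] G'_def [symmetric] z
      by (simp add: algebra_simps power2_eq_square rz)
    then show ?thesis
      unfolding 1 2 3 by simp
  qed
  then have "eventually (\<lambda>r. ?f r = (B'\<^sup>2 + 2 * A' * C' + 2 * G) / r\<^sup>2 + 2 * B' * C' / r ^ 3 + C'\<^sup>2 / r ^ 4) at_top"
    by (intro eventually_at_top_linorderI[of 1]) auto
  then show ?thesis
    using inverse_powers_bigo by (subst landau_o.big.in_cong)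
qed

section \<open>Growth and derivatives of the truncations\<close>

lemma linear_expansion_bigo:
  fixes a b c d :: real
  shows "(\<lambda>r::real. a * r + b + c / r + d / r\<^sup>2) \<in> O(\<lambda>r. r)"
proof -
  have "norm (a * r + b + c / r + d / r\<^sup>2) \<le> (\<bar>a\<bar> + \<bar>b\<bar> + \<bar>c\<bar> + \<bar>d\<bar>) * norm r" if "r \<ge> 1" for r
  proof -
    have le: "\<bar>b\<bar> \<le> \<bar>b\<bar> * r" "\<bar>c\<bar> / r \<le> \<bar>c\<bar> * r" "\<bar>d\<bar> / r\<^sup>2 \<le> \<bar>d\<bar> * r"
    proof -
      have "1 / r \<le> r" "1 / r\<^sup>2 \<le> r"
        using that one_le_power[of r 2] one_le_power[of r 3]
        by (auto simp: field_simps power2_eq_square power3_eq_cube)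
      then show "\<bar>b\<bar> \<le> \<bar>b\<bar> * r" "\<bar>c\<bar> / r \<le> \<bar>c\<bar> * r" "\<bar>d\<bar> / r\<^sup>2 \<le> \<bar>d\<bar> * r"
        using that mult_left_mono[of "1 / r" r "\<bar>c\<bar>"] mult_left_mono[of "1 / r\<^sup>2" r "\<bar>d\<bar>"]
          mult_left_mono[of 1 r "\<bar>b\<bar>"] by auto
    qed
    have "\<bar>a * r + b + c / r + d / r\<^sup>2\<bar> \<le> \<bar>a * r\<bar> + \<bar>b\<bar> + \<bar>c / r\<bar> + \<bar>d / r\<^sup>2\<bar>"
      by linarith
    also have "\<dots> = \<bar>a\<bar> * r + \<bar>b\<bar> + \<bar>c\<bar> / r + \<bar>d\<bar> / r\<^sup>2"
      using that by (simp add: abs_mult abs_divide)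
    finally show ?thesis
      using le that by (simp add: algebra_simps)
  qed
  then show ?thesis
    by (intro bigoI[where c = "\<bar>a\<bar> + \<bar>b\<bar> + \<bar>c\<bar> + \<bar>d\<bar>"] eventually_at_top_linorderI[of 1])
qed

lemma approx_bigo:
  "alpha_approx \<alpha> \<nu> \<in> O(\<lambda>r. r)" "beta_approx \<alpha> \<nu> \<in> O(\<lambda>r. r)" "alpha_sum_approx \<alpha> \<nu> \<in> O(\<lambda>r. r)"
  using linear_expansion_bigo[of 1 "alpha_coeff0 \<alpha> \<nu>" "alpha_coeff1 \<alpha> \<nu>" "alpha_coeff2 \<alpha> \<nu>"]
    linear_expansion_bigo[of "\<nu> / 2" "beta_coeff0 \<alpha> \<nu>" "beta_coeff1 \<alpha> \<nu>" "beta_coeff2 \<alpha> \<nu>"]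
    linear_expansion_bigo[of \<nu> "beta_coeff0 \<alpha> \<nu>" "2 / 3 * beta_coeff1 \<alpha> \<nu>" "beta_coeff2 \<alpha> \<nu> / 2"]
  by (simp_all add: alpha_approx_def [abs_def] beta_approx_def [abs_def] alpha_sum_approx_def [abs_def])

lemma alpha_approx_deriv:
  "r > 0 \<Longrightarrow> (alpha_approx \<alpha> \<nu> has_real_derivative
     1 - alpha_coeff1 \<alpha> \<nu> / r\<^sup>2 - 2 * alpha_coeff2 \<alpha> \<nu> / r ^ 3) (at r)"
  unfolding alpha_approx_def [abs_def]
  by (auto intro!: derivative_eq_intros simp: field_simps power2_eq_square power3_eq_cube)

lemma beta_approx_deriv:
  "r > 0 \<Longrightarrow> (beta_approx \<alpha> \<nu> has_real_derivative
     \<nu> / 2 - beta_coeff1 \<alpha> \<nu> / r\<^sup>2 - 2 * beta_coeff2 \<alpha> \<nu> / r ^ 3) (at r)"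
  unfolding beta_approx_def [abs_def]
  by (auto intro!: derivative_eq_intros simp: field_simps power2_eq_square power3_eq_cube)

text \<open>Solving (r/2) y' = ... for y' contributes the factor \<open>2 / r\<close>; it turns a
  residual of order 1/r^2 into a forcing term of order 1/r^3, the accuracy claimed.\<close>

lemma two_over_bigo:
  assumes "f \<in> O(\<lambda>r::real. 1 / r\<^sup>2)"
  shows "(\<lambda>r. 2 * f r / r) \<in> O(\<lambda>r. 1 / r ^ 3)"
proof -
  have "(\<lambda>r. f r * (2 / r)) \<in> O(\<lambda>r::real. 1 / r\<^sup>2 * (1 / r))"
    by (intro landau_o.big.mult assms) real_asymp
  then show ?thesis
    by (simp add: power3_eq_cube power2_eq_square mult.commute)
qed

lemma cubic_imp_square_bigo:
  assumes "f \<in> O(\<lambda>r::real. 1 / r ^ 3)"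
  shows "f \<in> O(\<lambda>r. 1 / r\<^sup>2)"
  by (rule landau_o.big.trans[OF assms]) real_asymp

lemma bigo_of_approx:
  assumes "(\<lambda>r. f r - g r) \<in> O(\<lambda>r::real. 1 / r ^ 3)" and "g \<in> O(\<lambda>r. r)"
  shows "f \<in> O(\<lambda>r. r)"
proof -
  have "(\<lambda>r::real. 1 / r ^ 3) \<in> O(\<lambda>r. r)"
    by real_asymp
  then have "(\<lambda>r. f r - g r) \<in> O(\<lambda>r. r)"
    using assms(1) landau_o.big.trans by blast
  from sum_in_bigo(1)[OF this assms(2)] show ?thesis
    by simp
qed

section \<open>Nonnegative solutions of the Toda and string equations\<close>

text \<open>Here \<open>u n r\<close> and \<open>v n r\<close> stand for the recurrence coefficients
  at t = r^2. From here on orthogonality is forgotten: the asymptotics follow from these equations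
  and the signs alone.\<close>

locale toda_recurrence =
  fixes \<alpha> :: real and u v :: "nat \<Rightarrow> real \<Rightarrow> real"
  assumes u_deriv: "\<And>n r. r > 0 \<Longrightarrow>
      (u n has_real_derivative 2 * (u n r + v n r - v (Suc n) r) / r) (at r)"
    and v_Suc_deriv: "\<And>n r. r > 0 \<Longrightarrow>
      (v (Suc n) has_real_derivative 2 * (v (Suc n) r * (2 + u n r - u (Suc n) r)) / r) (at r)"
    and v_0: "v 0 = (\<lambda>_. 0)"
    and string_equation: "\<And>n r. r > 0 \<Longrightarrow>
      (u n r)\<^sup>2 + v n r + v (Suc n) r = r\<^sup>2 + 2 * (\<Sum>j<n. u j r) + (2 * real n + 2 + \<alpha>) * u n r"
    and u_nonneg: "\<And>n r. r > 0 \<Longrightarrow> u n r \<ge> 0"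
    and v_nonneg: "\<And>n r. r > 0 \<Longrightarrow> v n r \<ge> 0"
begin

section \<open>Partial sums and their evolution\<close>

definition u_sum :: "nat \<Rightarrow> real \<Rightarrow> real" where
  "u_sum n r = (\<Sum>j<n. u j r)"

definition square_sum :: "nat \<Rightarrow> real \<Rightarrow> real" where
  "square_sum n r = (\<Sum>j<n. (u j r)\<^sup>2 + 2 * v j r)"

text \<open>The differences of consecutive \<open>v\<close> telescope, and \<open>v 0\<close>
  vanishes.\<close>

lemma u_sum_deriv:
  "r > 0 \<Longrightarrow> (u_sum n has_real_derivative 2 * (u_sum n r - v n r) / r) (at r)"
proof (induction n)
  case 0
  then show ?case by (simp add: u_sum_def [abs_def] v_0)
next
  case (Suc n)
  have "u_sum (Suc n) = (\<lambda>r. u_sum n r + u n r)"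
    by (simp add: u_sum_def [abs_def])
  then show ?case
    using Suc.prems
    by (auto intro!: derivative_eq_intros Suc.IH u_deriv simp: field_simps)
qed

text \<open>For n = 0 the index \<open>n - 1\<close> is truncated to 0, which is harmless because
  \<open>v 0\<close> vanishes identically.\<close>

lemma v_deriv:
  "r > 0 \<Longrightarrow> (v n has_real_derivative 2 * (v n r * (2 + u (n - 1) r - u n r)) / r) (at r)"
  using v_Suc_deriv[of r "n - 1"] by (cases n) (auto simp: v_0)

text \<open>Differentiating the string equation along the Toda flow gives the first difference of this one.\<close>

lemma second_string_equation:
  assumes r: "r > 0"
  shows "square_sum n r + (2 * real n + 1 + \<alpha>) * v n r = v n r * (u n r + u (n - 1) r)"
proof (induction n)
  case 0
  then show ?case by (simp add: square_sum_def v_0)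
next
  case (Suc n)
  define k where "k = 2 * real n + 2 + \<alpha>"
  \<comment> \<open>\<open>D\<close> is the defect of the string equation. It vanishes on the whole
    half-line, so the derivative computed from the Toda equations must be 0 as well.\<close>
  define D where "D r = (u n r)\<^sup>2 + v n r + v (Suc n) r - r\<^sup>2 - 2 * u_sum n r - k * u n r" for r
  define w where "w = u n r + v n r - v (Suc n) r"
  have "(D has_real_derivative 2 / r * (2 * u n r * w + v n r * (2 + u (n - 1) r - u n r)
      + v (Suc n) r * (2 + u n r - u (Suc n) r) - r\<^sup>2 - 2 * (u_sum n r - v n r) - k * w)) (at r)"
    unfolding D_def [abs_def]
    by (rule derivative_eq_intros u_deriv[OF r] v_deriv[OF r] v_Suc_deriv[OF r] u_sum_deriv[OF r] refl)+
       (use r in \<open>simp add: w_def [symmetric] field_simps power2_eq_square\<close>)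
  moreover have "(D has_real_derivative 0) (at r)"
  proof (rule has_field_derivative_transform_within_open)
    show "((\<lambda>_. 0) has_real_derivative 0) (at r)" "open {0::real<..}" "r \<in> {0<..}"
      using r by auto
    show "0 = D x" if "x \<in> {0<..}" for x
      using string_equation[of x n] that by (simp add: D_def u_sum_def k_def)
  qed
  ultimately have 1: "2 * u n r * w + v n r * (2 + u (n - 1) r - u n r)
      + v (Suc n) r * (2 + u n r - u (Suc n) r) - r\<^sup>2 - 2 * (u_sum n r - v n r) - k * w = 0"
    using DERIV_unique r by fastforce
  have 2: "(u n r)\<^sup>2 + v n r + v (Suc n) r = r\<^sup>2 + 2 * u_sum n r + k * u n r"
    using string_equation[OF r, of n] by (simp add: u_sum_def k_def)
  have 3: "square_sum n r + (k - 1) * v n r = v n r * (u n r + u (n - 1) r)"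
    using Suc.IH by (simp add: k_def algebra_simps)
  have "square_sum n r + (u n r)\<^sup>2 + 2 * v n r + (k + 1) * v (Suc n) r
      = v (Suc n) r * (u (Suc n) r + u n r)"
    \<comment> \<open>Fact 2 eliminates the square of \<open>r\<close> together with
      \<open>u_sum n r\<close> from fact 1, and the induction hypothesis 3 eliminates
      \<open>v n r * u (n - 1) r\<close>.\<close>
    using 1 2 3 unfolding w_def by algebra
  moreover have "square_sum (Suc n) r = square_sum n r + (u n r)\<^sup>2 + 2 * v n r"
    by (simp add: square_sum_def)
  moreover have "2 * real (Suc n) + 1 + \<alpha> = k + 1"
    by (simp add: k_def)
  ultimately show ?case
    unfolding diff_Suc_1 by (simp only:)
qed

text \<open>Subtracting the Riccati equations of \<open>u n\<close> and its truncation factors the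
  difference of squares, so the error obeys a linear equation with growth rate
  \<open>G r = 2 * (u n r + p r - c) / r\<close>. The forcing consists of the residual and of the
  errors of \<open>v n\<close> and \<open>u_sum n\<close>.\<close>

lemma u_approx_bigo:
  assumes S: "(\<lambda>r. u_sum n r - alpha_sum_approx \<alpha> n r) \<in> O(\<lambda>r. 1 / r ^ 3)"
    and V: "(\<lambda>r. v n r - beta_approx \<alpha> n r) \<in> O(\<lambda>r. 1 / r ^ 3)"
  shows "(\<lambda>r. u n r - alpha_approx \<alpha> n r) \<in> O(\<lambda>r. 1 / r ^ 3)"
proof -
  define c where "c = 2 * real n + 1 + \<alpha>"
  define p where "p = alpha_approx \<alpha> n"
  define q where "q = beta_approx \<alpha> n"
  define s where "s = alpha_sum_approx \<alpha> n"
  define p' where "p' r = 1 - alpha_coeff1 \<alpha> n / r\<^sup>2 - 2 * alpha_coeff2 \<alpha> n / r ^ 3" for r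
  define G where "G r = 2 * (u n r + p r - c) / r" for r
  define E where "E r = 2 * (((p r)\<^sup>2 - c * p r + 2 * q r - 2 * s r - r\<^sup>2 - r / 2 * p' r)
      + 2 * (v n r - q r) - 2 * (u_sum n r - s r)) / r" for r
  have deriv: "((\<lambda>r. u n r - p r) has_real_derivative G r * (u n r - p r) + E r) (at r)" if r: "r > 0" for r
  proof -
    have "((\<lambda>r. u n r - p r) has_real_derivative 2 * (u n r + v n r - v (Suc n) r) / r - p' r) (at r)"
      unfolding p_def p'_def by (intro DERIV_diff u_deriv alpha_approx_deriv r)
    \<comment> \<open>The string equation trades \<open>v (Suc n)\<close>, whose expansion is not
      yet available, for quantities of index at most n.\<close>
    moreover have "u n r + v n r - v (Suc n) r = (u n r)\<^sup>2 - c * u n r + 2 * v n r - 2 * u_sum n r - r\<^sup>2"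
      using string_equation[OF r, of n] by (simp add: c_def u_sum_def algebra_simps)
    moreover have "2 * ((u n r)\<^sup>2 - c * u n r + 2 * v n r - 2 * u_sum n r - r\<^sup>2) / r - p' r
        = G r * (u n r - p r) + E r"
      using r by (simp add: G_def E_def field_simps power2_eq_square)
    ultimately show ?thesis by simp
  qed
  have E: "E \<in> O(\<lambda>r. 1 / r ^ 3)"
    unfolding E_def [abs_def]
  proof (rule two_over_bigo)
    have 1: "(\<lambda>r. (p r)\<^sup>2 - c * p r + 2 * q r - 2 * s r - r\<^sup>2 - r / 2 * p' r) \<in> O(\<lambda>r. 1 / r\<^sup>2)"
      unfolding p_def q_def s_def p'_def c_def by (rule riccati_residual_bigo)
    have 2: "(\<lambda>r. 2 * (v n r - q r)) \<in> O(\<lambda>r. 1 / r\<^sup>2)"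
      unfolding q_def using cubic_imp_square_bigo[OF V] by (rule landau_o.big.cmult_in_iff [THEN iffD2, rotated]) simp
    have 3: "(\<lambda>r. 2 * (u_sum n r - s r)) \<in> O(\<lambda>r. 1 / r\<^sup>2)"
      unfolding s_def using cubic_imp_square_bigo[OF S] by (rule landau_o.big.cmult_in_iff [THEN iffD2, rotated]) simp
    show "(\<lambda>r. ((p r)\<^sup>2 - c * p r + 2 * q r - 2 * s r - r\<^sup>2 - r / 2 * p' r)
        + 2 * (v n r - q r) - 2 * (u_sum n r - s r)) \<in> O(\<lambda>r. 1 / r\<^sup>2)"
      by (rule sum_in_bigo(2)[OF sum_in_bigo(1)[OF 1 2] 3])
  qed
  have G: "eventually (\<lambda>r. G r \<ge> 1) at_top"
  proof -
    \<comment> \<open>Since \<open>u n r\<close> is nonnegative, the leading term \<open>r\<close>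
      of the truncation alone pushes the growth rate above 1.\<close>
    have "eventually (\<lambda>r. 2 * (p r - c) \<ge> r) at_top"
      unfolding p_def alpha_approx_def by real_asymp
    then show ?thesis
      using eventually_gt_at_top[of 0]
    proof eventually_elim
      case (elim r)
      then show ?case
        using u_nonneg[of r n] by (simp add: G_def field_simps)
    qed
  qed
  have "u n \<in> O(\<lambda>r. r\<^sup>2)"
  proof -
    define k where "k = 2 * real n + 2 + \<alpha>"
    have bound: "norm (u n r) \<le> norm (\<bar>k\<bar> + 1 + r\<^sup>2 + 2 * \<bar>u_sum n r\<bar>)" if r: "r > 0" for r
    \<comment> \<open>Above this threshold \<open>u n r - k\<close> is at least 1, so
      \<open>u n r\<close> is at most \<open>u n r * (u n r - k)\<close>, which the string equation
      bounds once the nonnegative \<open>v\<close> terms are dropped.\<close>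
    proof (cases "u n r \<ge> \<bar>k\<bar> + 1")
      case True
      have "u n r * 1 \<le> u n r * (u n r - k)"
        using True by (intro mult_left_mono) auto
      also have "\<dots> \<le> r\<^sup>2 + 2 * u_sum n r"
        using string_equation[OF r, of n] v_nonneg[OF r, of n] v_nonneg[OF r, of "Suc n"]
        by (simp add: k_def u_sum_def algebra_simps power2_eq_square)
      finally show ?thesis
        using u_nonneg[OF r, of n] by simp
    next
      case False
      then show ?thesis
        using u_nonneg[OF r, of n] zero_le_power2[of r] unfolding real_norm_def by linarith
    qed
    have "u_sum n \<in> O(\<lambda>r. r)"
      using bigo_of_approx[OF S] approx_bigo by blast
    then have "u_sum n \<in> O(\<lambda>r. r\<^sup>2)"
      by (rule landau_o.big.trans) real_asymp
    then have "(\<lambda>r. 2 * \<bar>u_sum n r\<bar>) \<in> O(\<lambda>r. r\<^sup>2)"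
      by simp
    moreover have "(\<lambda>r::real. \<bar>k\<bar> + 1 + r\<^sup>2) \<in> O(\<lambda>r. r\<^sup>2)"
      by real_asymp
    ultimately have "(\<lambda>r. \<bar>k\<bar> + 1 + r\<^sup>2 + 2 * \<bar>u_sum n r\<bar>) \<in> O(\<lambda>r. r\<^sup>2)"
      using sum_in_bigo(1) by blast
    then show ?thesis
      by (rule landau_o.big.trans[OF landau_o.big_mono, rotated])
        (intro eventually_mono[OF eventually_gt_at_top[of 0]] bound)
  qed
  moreover have "p \<in> O(\<lambda>r. r\<^sup>2)"
    unfolding p_def by (rule landau_o.big.trans[OF approx_bigo(1)]) real_asymp
  ultimately have growth: "(\<lambda>r. u n r - p r) \<in> O(\<lambda>r. r\<^sup>2)"
    by (rule sum_in_bigo)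
  have "(\<lambda>r. u n r - p r) \<in> O(\<lambda>r. 1 / r ^ 3)"
    by (rule growing_ode_bigo[OF eventually_mono[OF eventually_gt_at_top[of 0] deriv] G _ E growth]) auto
  then show ?thesis
    by (simp add: p_def)
qed

text \<open>The second string equation makes the equation for \<open>v (Suc n)\<close> linear, with
  growth rate \<open>2 * (K + 2 * u n r) / r\<close>, which tends to 4.
  \<open>square_sum (Suc n)\<close> involves only indices up to n, so its expansion is already
  known.\<close>

lemma v_approx_bigo:
  assumes X: "(\<lambda>r. square_sum (Suc n) r - square_sum_approx \<alpha> (Suc n) r) \<in> O(\<lambda>r. 1 / r\<^sup>2)"
    and S: "(\<lambda>r. u_sum n r - alpha_sum_approx \<alpha> n r) \<in> O(\<lambda>r. 1 / r ^ 3)"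
    and U: "(\<lambda>r. u n r - alpha_approx \<alpha> n r) \<in> O(\<lambda>r. 1 / r ^ 3)"
  shows "(\<lambda>r. v (Suc n) r - beta_approx \<alpha> (Suc n) r) \<in> O(\<lambda>r. 1 / r ^ 3)"
proof -
  define K where "K = 1 - 2 * real (Suc n) - \<alpha>"
  define p where "p = alpha_approx \<alpha> n"
  define q where "q = beta_approx \<alpha> (Suc n)"
  define x where "x = square_sum_approx \<alpha> (Suc n)"
  define q' where "q' r = real (Suc n) / 2 - beta_coeff1 \<alpha> (Suc n) / r\<^sup>2 - 2 * beta_coeff2 \<alpha> (Suc n) / r ^ 3" for r
  define G where "G r = 2 * (K + 2 * u n r) / r" for r
  define E where "E r = 2 * ((q r * (K + 2 * p r) - x r - r / 2 * q' r)
      + 2 * (q r * (u n r - p r)) - (square_sum (Suc n) r - x r)) / r" for r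
  have deriv: "((\<lambda>r. v (Suc n) r - q r) has_real_derivative G r * (v (Suc n) r - q r) + E r) (at r)"
    if r: "r > 0" for r
  proof -
    have "((\<lambda>r. v (Suc n) r - q r) has_real_derivative
        2 * (v (Suc n) r * (2 + u n r - u (Suc n) r)) / r - q' r) (at r)"
      unfolding q_def q'_def by (intro DERIV_diff v_Suc_deriv beta_approx_deriv r)
    \<comment> \<open>The second string equation at \<open>Suc n\<close> removes the unknown
      \<open>u (Suc n)\<close>.\<close>
    moreover have "v (Suc n) r * (2 + u n r - u (Suc n) r)
        = v (Suc n) r * (K + 2 * u n r) - square_sum (Suc n) r"
      using second_string_equation[OF r, of "Suc n"] by (simp add: K_def algebra_simps)
    moreover have "2 * (v (Suc n) r * (K + 2 * u n r) - square_sum (Suc n) r) / r - q' r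
        = G r * (v (Suc n) r - q r) + E r"
      using r by (simp add: G_def E_def field_simps)
    ultimately show ?thesis by simp
  qed
  have E: "E \<in> O(\<lambda>r. 1 / r ^ 3)"
    unfolding E_def [abs_def]
  proof (rule two_over_bigo)
    have 1: "(\<lambda>r. q r * (K + 2 * p r) - x r - r / 2 * q' r) \<in> O(\<lambda>r. 1 / r\<^sup>2)"
      using linear_residual_bigo[of \<alpha> "real (Suc n)"]
      by (simp add: p_def q_def x_def q'_def K_def)
    \<comment> \<open>The factor \<open>q\<close> grows like \<open>r\<close> and costs one power,
      so the order 1/r^3 of the error of \<open>u n\<close> is just what the required 1/r^2
      demands.\<close>
    have "(\<lambda>r. q r * (u n r - p r)) \<in> O(\<lambda>r. r * (1 / r ^ 3))"
      unfolding p_def q_def by (intro landau_o.big.mult approx_bigo U)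
    also have "(\<lambda>r::real. r * (1 / r ^ 3)) \<in> O(\<lambda>r. 1 / r\<^sup>2)"
      by real_asymp
    finally have 2: "(\<lambda>r. 2 * (q r * (u n r - p r))) \<in> O(\<lambda>r. 1 / r\<^sup>2)"
      by (rule landau_o.big.cmult_in_iff [THEN iffD2, rotated]) simp
    show "(\<lambda>r. (q r * (K + 2 * p r) - x r - r / 2 * q' r)
        + 2 * (q r * (u n r - p r)) - (square_sum (Suc n) r - x r)) \<in> O(\<lambda>r. 1 / r\<^sup>2)"
      by (rule sum_in_bigo(2)[OF sum_in_bigo(1)[OF 1 2] X [folded x_def]])
  qed
  have G: "eventually (\<lambda>r. G r \<ge> 1) at_top"
  proof -
    have "(\<lambda>r. u n r - p r) \<in> o(\<lambda>_. 1)"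
      unfolding p_def by (rule landau_o.big_small_trans[OF U]) real_asymp
    from landau_o.smallD[OF this, of 1] have "eventually (\<lambda>r. \<bar>u n r - p r\<bar> \<le> 1) at_top"
      by simp
    moreover have "eventually (\<lambda>r. 2 * (K + 2 * (p r - 1)) \<ge> r) at_top"
      unfolding p_def alpha_approx_def by real_asymp
    ultimately show ?thesis
      using eventually_gt_at_top[of 0]
      by eventually_elim (auto simp: G_def field_simps)
  qed
  have "v (Suc n) \<in> O(\<lambda>r. r\<^sup>2)"
  proof -
    define k where "k = 2 * real n + 2 + \<alpha>"
    \<comment> \<open>The string equation bounds \<open>v (Suc n) r\<close> after the nonnegative
      terms \<open>(u n r)\<^sup>2\<close> and \<open>v n r\<close> are dropped.\<close>
    have bound: "norm (v (Suc n) r) \<le> norm (r\<^sup>2 + 2 * u_sum n r + k * u n r)" if r: "r > 0" for r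
      using string_equation[OF r, of n] v_nonneg[OF r, of n] v_nonneg[OF r, of "Suc n"]
        zero_le_power2[of "u n r"]
      unfolding k_def u_sum_def real_norm_def by linarith
    have le: "(\<lambda>r::real. r) \<in> O(\<lambda>r. r\<^sup>2)"
      by real_asymp
    have "u_sum n \<in> O(\<lambda>r. r\<^sup>2)" "u n \<in> O(\<lambda>r. r\<^sup>2)"
      using bigo_of_approx[OF S approx_bigo(3)] bigo_of_approx[OF U approx_bigo(1)]
        landau_o.big.trans[OF _ le] by blast+
    then have "(\<lambda>r. 2 * u_sum n r) \<in> O(\<lambda>r. r\<^sup>2)" "(\<lambda>r. k * u n r) \<in> O(\<lambda>r. r\<^sup>2)"
      by (simp, cases "k = 0") auto
    then have "(\<lambda>r. r\<^sup>2 + 2 * u_sum n r + k * u n r) \<in> O(\<lambda>r. r\<^sup>2)"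
      by (intro sum_in_bigo(1)) auto
    then show ?thesis
      by (rule landau_o.big.trans[OF landau_o.big_mono, rotated])
        (intro eventually_mono[OF eventually_gt_at_top[of 0]] bound)
  qed
  moreover have "q \<in> O(\<lambda>r. r\<^sup>2)"
    unfolding q_def by (rule landau_o.big.trans[OF approx_bigo(2)]) real_asymp
  ultimately have growth: "(\<lambda>r. v (Suc n) r - q r) \<in> O(\<lambda>r. r\<^sup>2)"
    by (rule sum_in_bigo)
  have "(\<lambda>r. v (Suc n) r - q r) \<in> O(\<lambda>r. 1 / r ^ 3)"
    by (rule growing_ode_bigo[OF eventually_mono[OF eventually_gt_at_top[of 0] deriv] G _ E growth]) auto
  then show ?thesis
    by (simp add: q_def)
qed

text \<open>The error of the square of \<open>u n\<close> factors into the error of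
  \<open>u n\<close> times a sum of order \<open>r\<close>, hence one order is lost against the
  error of \<open>u n\<close>.\<close>

lemma square_sum_bigo:
  assumes X: "(\<lambda>r. square_sum n r - square_sum_approx \<alpha> n r) \<in> O(\<lambda>r. 1 / r\<^sup>2)"
    and U: "(\<lambda>r. u n r - alpha_approx \<alpha> n r) \<in> O(\<lambda>r. 1 / r ^ 3)"
    and V: "(\<lambda>r. v n r - beta_approx \<alpha> n r) \<in> O(\<lambda>r. 1 / r ^ 3)"
  shows "(\<lambda>r. square_sum (Suc n) r - square_sum_approx \<alpha> (Suc n) r) \<in> O(\<lambda>r. 1 / r\<^sup>2)"
proof -
  define p where "p = alpha_approx \<alpha> n"
  have "(\<lambda>r. (u n r - p r) * (u n r + p r)) \<in> O(\<lambda>r. 1 / r ^ 3 * r)"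
    unfolding p_def
    by (intro landau_o.big.mult U sum_in_bigo approx_bigo bigo_of_approx[OF U])
  also have "(\<lambda>r::real. 1 / r ^ 3 * r) \<in> O(\<lambda>r. 1 / r\<^sup>2)"
    by real_asymp
  finally have 1: "(\<lambda>r. (u n r - p r) * (u n r + p r)) \<in> O(\<lambda>r. 1 / r\<^sup>2)" .
  have 2: "(\<lambda>r. 2 * (v n r - beta_approx \<alpha> n r)) \<in> O(\<lambda>r. 1 / r\<^sup>2)"
    using cubic_imp_square_bigo[OF V] by (rule landau_o.big.cmult_in_iff [THEN iffD2, rotated]) simp
  have "(\<lambda>r. (square_sum n r - square_sum_approx \<alpha> n r) + (u n r - p r) * (u n r + p r)
      + 2 * (v n r - beta_approx \<alpha> n r)
      + (square_sum_approx \<alpha> n r + (p r)\<^sup>2 + 2 * beta_approx \<alpha> n r - square_sum_approx \<alpha> (real n + 1) r))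
    \<in> O(\<lambda>r. 1 / r\<^sup>2)"
    using square_sum_step_bigo[of \<alpha> "real n"] unfolding p_def [symmetric]
    by (intro sum_in_bigo(1) X 1 2)
  then show ?thesis
    by (simp add: square_sum_def algebra_simps power2_eq_square)
qed

text \<open>In the step from n to n + 1, the sum and \<open>v\<close> at n give \<open>u n\<close>.
  This gives both sums at n + 1, and these data finally give \<open>v (Suc n)\<close>. The expansion
  of \<open>u n\<close> is derived inside each step, so it is not part of the induction
  statement.\<close>

lemma asymptotic_expansions:
  "(\<lambda>r. u_sum n r - alpha_sum_approx \<alpha> n r) \<in> O(\<lambda>r. 1 / r ^ 3)"
  "(\<lambda>r. square_sum n r - square_sum_approx \<alpha> n r) \<in> O(\<lambda>r. 1 / r\<^sup>2)"
  "(\<lambda>r. v n r - beta_approx \<alpha> n r) \<in> O(\<lambda>r. 1 / r ^ 3)"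
proof (induction n)
  case 0
  {
    case 1
    then show ?case by (simp add: u_sum_def)
  next
    case 2
    then show ?case by (simp add: square_sum_def)
  next
    case 3
    then show ?case by (simp add: v_0)
  }
next
  case (Suc n)
  note U = u_approx_bigo[OF Suc.IH(1,3)]
  note X = square_sum_bigo[OF Suc.IH(2) U Suc.IH(3)]
  {
    case 1
    have "(\<lambda>r. (u_sum n r - alpha_sum_approx \<alpha> n r) + (u n r - alpha_approx \<alpha> n r)) \<in> O(\<lambda>r. 1 / r ^ 3)"
      by (intro sum_in_bigo Suc.IH U)
    then show ?case
      using alpha_sum_approx_step[of \<alpha> "real n"] by (simp add: u_sum_def algebra_simps)
  next
    case 2
    show ?case by (rule X)
  next
    case 3
    show ?case by (rule v_approx_bigo[OF X Suc.IH(1) U])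
  }
qed

end

section \<open>Moments of the weight\<close>

text \<open>Follows from (1 + y/k)^k \<le> exp y. Applied to y = t/x it produces as many powers of x
  as wanted near 0.\<close>

lemma exp_neg_le_power:
  fixes y :: real
  assumes "y > 0" "k > 0"
  shows "exp (- y) \<le> (real k / y) ^ k"
proof -
  have "(y / k) ^ k \<le> (1 + y / k) ^ k"
    using assms by (intro power_mono) auto
  also have "\<dots> \<le> exp y"
    using assms by (intro exp_ge_one_plus_x_over_n_power_n) auto
  finally show ?thesis
    using assms by (simp add: exp_minus field_simps)
qed

text \<open>A quadratic Taylor remainder valid for both signs of y, obtained from exp y \<ge> 1 + y
  at y and at -y.\<close>

lemma abs_exp_diff_le:
  fixes y :: real
  shows "\<bar>exp y - 1 - y\<bar> \<le> y\<^sup>2 * exp \<bar>y\<bar>"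
proof -
  have "exp y - 1 - y \<ge> 0"
    using exp_ge_add_one_self[of y] by linarith
  moreover have "exp y * (1 - y) \<le> exp y * exp (- y)"
    using exp_ge_add_one_self[of "- y"] by (intro mult_left_mono) auto
  then have "exp y - 1 - y \<le> y * (exp y - 1)"
    by (simp add: exp_minus algebra_simps)
  moreover have "y * (exp y - 1) \<le> y\<^sup>2 * exp \<bar>y\<bar>"
  proof (cases "y \<ge> 0")
    case True
    have "exp y - 1 \<le> y * exp y"
      using \<open>exp y * (1 - y) \<le> exp y * exp (- y)\<close> by (simp add: exp_minus algebra_simps)
    then show ?thesis
      using True mult_left_mono[of "exp y - 1" "y * exp y" y] by (simp add: power2_eq_square)
  next
    case False
    have "y * (exp y - 1) \<le> y * y"
      using False exp_ge_add_one_self[of y] by (intro mult_left_mono_neg) linarith+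
    also have "\<dots> \<le> y * y * exp \<bar>y\<bar>"
      using mult_left_mono[of 1 "exp \<bar>y\<bar>" "y * y"] by simp
    finally show ?thesis by (simp add: power2_eq_square)
  qed
  ultimately show ?thesis by linarith
qed

lemma gamma_integrand_integrable:
  assumes "s > -1"
  shows "set_integrable lborel {0<..} (\<lambda>x::real. x powr s * exp (- x))"
proof -
  have "set_integrable lborel {0..} (\<lambda>x::real. x powr s * exp (- x))"
    unfolding set_integrable_def
  proof (rule integrableI_nonneg)
    show "AE x in lborel. 0 \<le> indicat_real {0..} x *\<^sub>R (x powr s * exp (- x))"
      by simp
    have "(\<integral>\<^sup>+ x. ennreal (indicat_real {0..} x *\<^sub>R (x powr s * exp (- x))) \<partial>lborel) = ennreal (Gamma (s + 1))"
      using Gamma_conv_nn_integral_real[of "s + 1"] assms by (simp add: exp_minus field_simps)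
    then show "(\<integral>\<^sup>+ x. ennreal (indicat_real {0..} x *\<^sub>R (x powr s * exp (- x))) \<partial>lborel) < \<infinity>"
      by simp
  qed measurable
  then show ?thesis
    by (rule set_integrable_subset) auto
qed

lemma laguerre_weight_nonneg: "laguerre_weight s t x \<ge> 0"
  by (simp add: laguerre_weight_def)

lemma laguerre_weight_shift:
  "x > 0 \<Longrightarrow> x ^ k * laguerre_weight s t x = laguerre_weight (s + real k) t x"
  by (simp add: laguerre_weight_def powr_add powr_realpow)

lemma laguerre_weight_divide:
  assumes "x > 0"
  shows "laguerre_weight s t x / x = laguerre_weight (s - 1) t x"
    "laguerre_weight s t x / x\<^sup>2 = laguerre_weight (s - 2) t x"
proof -
  have "x powr (s - 1) = x powr s / x" "x powr (s - 2) = x powr s / x\<^sup>2"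
    using assms by (simp_all add: powr_diff)
  then show "laguerre_weight s t x / x = laguerre_weight (s - 1) t x"
    "laguerre_weight s t x / x\<^sup>2 = laguerre_weight (s - 2) t x"
    by (simp_all add: laguerre_weight_def)
qed

text \<open>For \<open>t > 0\<close> the factor \<open>exp (- t / x)\<close> makes every real power integrable at \<open>0\<close>.\<close>

lemma laguerre_weight_integrable:
  assumes t: "t > 0"
  shows "set_integrable lborel {0<..} (laguerre_weight s t)"
proof -
  \<comment> \<open>This many powers of x lift the exponent \<open>s + k\<close> above 0, into the
    range of the Gamma integral.\<close>
  obtain k :: nat where k: "real k > \<bar>s\<bar>"
    using reals_Archimedean2 by blast
  then have "k > 0"
    by (cases k) auto
  have "set_integrable lborel {0<..} (\<lambda>x. (real k / t) ^ k * (x powr (s + k) * exp (- x)))"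
    by (intro set_integrable_mult_right gamma_integrand_integrable) (use k in linarith)
  then show ?thesis
  proof (rule set_integrable_bound)
    show "set_borel_measurable lborel {0<..} (laguerre_weight s t)"
      unfolding set_borel_measurable_def laguerre_weight_def by measurable
    have "laguerre_weight s t x \<le> (real k / t) ^ k * (x powr (s + k) * exp (- x))" if x: "x > 0" for x
    proof -
      have "laguerre_weight s t x = x powr s * exp (- x) * exp (- (t / x))"
        by (simp add: laguerre_weight_def exp_diff exp_minus field_simps)
      also have "\<dots> \<le> x powr s * exp (- x) * (real k / (t / x)) ^ k"
        using t x \<open>k > 0\<close> by (intro mult_left_mono exp_neg_le_power) auto
      also have "\<dots> = (real k / t) ^ k * (x powr (s + k) * exp (- x))"
        using x by (simp add: powr_add powr_realpow power_divide power_mult_distrib)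
      finally show ?thesis .
    qed
    then show "AE x in lborel. x \<in> {0<..} \<longrightarrow>
        norm (laguerre_weight s t x) \<le> norm ((real k / t) ^ k * (x powr (s + k) * exp (- x)))"
      using t by (auto simp: laguerre_weight_nonneg abs_mult)
  qed
qed

text \<open>The exponent is an arbitrary real, because differentiation in t and integration by parts
  lower it, possibly below -1.\<close>

definition moment :: "real \<Rightarrow> real \<Rightarrow> real" where
  "moment s t = (LBINT x:{0<..}. laguerre_weight s t x)"

text \<open>The integrand is the derivative of \<open>laguerre_weight s t\<close>, whose limits at 0
  and at infinity are both 0.\<close>

lemma moment_recurrence:
  assumes t: "t > 0"
  shows "s * moment (s - 1) t - moment s t + t * moment (s - 2) t = 0"
proof -
  define f where "f x = s * laguerre_weight (s - 1) t x - laguerre_weight s t x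
    + t * laguerre_weight (s - 2) t x" for x
  note integrable = laguerre_weight_integrable[OF t]
  have f: "set_integrable lborel {0<..} f"
    unfolding f_def [abs_def]
    by (intro set_integral_add set_integral_diff set_integrable_mult_right integrable)
  have "(LBINT x=ereal 0..\<infinity>. f x) = 0 - 0"
  proof (rule interval_integral_FTC_integrable[where F = "laguerre_weight s t"])
    show "(laguerre_weight s t has_vector_derivative f x) (at x)" if "ereal 0 < ereal x" for x
    proof -
      have x: "x > 0"
        using that by simp
      have "(laguerre_weight s t has_real_derivative
          s * (laguerre_weight s t x / x) - laguerre_weight s t x + t * (laguerre_weight s t x / x\<^sup>2)) (at x)"
        unfolding laguerre_weight_def [abs_def] using x
        by (auto intro!: derivative_eq_intros simp: field_simps power2_eq_square powr_diff)
      then show ?thesis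
        using x by (simp add: f_def laguerre_weight_divide has_real_derivative_iff_has_vector_derivative)
    qed
    show "isCont f x" if "ereal 0 < ereal x" for x
      using that unfolding f_def [abs_def] laguerre_weight_def [abs_def]
      by (auto intro!: continuous_intros)
    show "set_integrable lborel (einterval (ereal 0) \<infinity>) f"
      using f by (simp add: einterval_def greaterThan_def)
    have "(laguerre_weight s t \<longlongrightarrow> 0) (at_right 0)"
      unfolding laguerre_weight_def [abs_def] using t by real_asymp
    then show "((laguerre_weight s t \<circ> real_of_ereal) \<longlongrightarrow> 0) (at_right (ereal 0))"
      by (simp add: ereal_tendsto_simps)
    have "(laguerre_weight s t \<longlongrightarrow> 0) at_top"
      unfolding laguerre_weight_def [abs_def] using t by real_asymp
    then show "((laguerre_weight s t \<circ> real_of_ereal) \<longlongrightarrow> 0) (at_left \<infinity>)"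
      by (simp add: ereal_tendsto_simps)
  qed simp
  then have "(LBINT x:{0<..}. f x) = 0"
    by (simp add: interval_lebesgue_integral_def einterval_def greaterThan_def)
  then show ?thesis
    unfolding f_def moment_def
    by (simp add: integrable set_integral_add set_integral_diff)
qed

text \<open>The factor exp(-h/x) is expanded to first order pointwise. Its remainder carries
  exp(|h|/x) \<le> exp(t/(2x)), which only weakens the weight from t to t/2, so an integrable
  majorant remains. This takes the place of differentiation under the integral.\<close>

lemma moment_Taylor_bound:
  assumes t: "t > 0" and h: "\<bar>h\<bar> \<le> t / 2"
  shows "\<bar>moment s (t + h) - moment s t + h * moment (s - 1) t\<bar> \<le> h\<^sup>2 * moment (s - 2) (t / 2)"
proof -
  define f where "f x = laguerre_weight s (t + h) x - laguerre_weight s t x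
    + h * laguerre_weight (s - 1) t x" for x
  define g where "g x = h\<^sup>2 * laguerre_weight (s - 2) (t / 2) x" for x
  have pos: "t + h > 0" "t / 2 > 0"
    using t h by auto
  note integrable = laguerre_weight_integrable[OF t] laguerre_weight_integrable[OF pos(1)]
    laguerre_weight_integrable[OF pos(2)]
  have f: "set_integrable lborel {0<..} f"
    unfolding f_def [abs_def]
    by (intro set_integral_add set_integral_diff set_integrable_mult_right integrable)
  have g: "set_integrable lborel {0<..} g"
    unfolding g_def [abs_def] by (intro set_integrable_mult_right integrable)
  have fg: "\<bar>f x\<bar> \<le> g x" if x: "x > 0" for x
  proof -
    define y where "y = - h / x"
    have "f x = laguerre_weight s t x * (exp y - 1 - y)"
    proof -
      have "laguerre_weight s (t + h) x = laguerre_weight s t x * exp y"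
        by (simp add: laguerre_weight_def y_def exp_add [symmetric] add_divide_distrib)
      then show ?thesis
        using x by (simp add: f_def laguerre_weight_divide(1) [symmetric] y_def field_simps)
    qed
    then have "\<bar>f x\<bar> = laguerre_weight s t x * \<bar>exp y - 1 - y\<bar>"
      by (simp add: abs_mult laguerre_weight_nonneg)
    also have "\<dots> \<le> laguerre_weight s t x * (y\<^sup>2 * exp \<bar>y\<bar>)"
      by (intro mult_left_mono abs_exp_diff_le laguerre_weight_nonneg)
    also have "\<dots> \<le> laguerre_weight s t x * (y\<^sup>2 * exp (t / 2 / x))"
      using x h by (intro mult_left_mono laguerre_weight_nonneg) (auto simp: y_def field_simps)
    also have "\<dots> = h\<^sup>2 * (laguerre_weight s (t / 2) x / x\<^sup>2)"
    proof -
      have "laguerre_weight s (t / 2) x = laguerre_weight s t x * exp (t / 2 / x)"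
        using x by (simp add: laguerre_weight_def exp_add [symmetric] field_simps)
      then show ?thesis
        by (simp add: y_def power_divide)
    qed
    finally show ?thesis
      using x by (simp add: g_def laguerre_weight_divide)
  qed
  have "(LBINT x:{0<..}. f x) \<le> (LBINT x:{0<..}. g x)"
    using fg by (intro set_integral_mono f g) (force simp: abs_le_iff)
  moreover have "(LBINT x:{0<..}. - g x) \<le> (LBINT x:{0<..}. f x)"
    using fg set_integrable_mult_right[of "-1" lborel "{0<..}" g] g
    by (intro set_integral_mono f) (force simp: abs_le_iff)+
  moreover have "(LBINT x:{0<..}. - g x) = - (LBINT x:{0<..}. g x)"
    using set_integral_mult_right[where a = "-1" and f = g] by simp
  moreover have "(LBINT x:{0<..}. f x) = moment s (t + h) - moment s t + h * moment (s - 1) t"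
    unfolding f_def moment_def by (simp add: integrable set_integral_add set_integral_diff)
  moreover have "(LBINT x:{0<..}. g x) = h\<^sup>2 * moment (s - 2) (t / 2)"
    unfolding g_def moment_def by simp
  ultimately show ?thesis by linarith
qed

lemma moment_deriv:
  assumes t: "t > 0"
  shows "(moment s has_real_derivative - moment (s - 1) t) (at t)"
proof -
  define C where "C = moment (s - 2) (t / 2)"
  have bound: "norm ((moment s (t + h) - moment s t) / h - - moment (s - 1) t) \<le> C * \<bar>h\<bar>"
    if "h \<noteq> 0" "\<bar>h\<bar> < t / 2" for h
  proof -
    have "(moment s (t + h) - moment s t) / h - - moment (s - 1) t
        = (moment s (t + h) - moment s t + h * moment (s - 1) t) / h"
      using that by (simp add: field_simps)
    then have "norm ((moment s (t + h) - moment s t) / h - - moment (s - 1) t)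
        = \<bar>moment s (t + h) - moment s t + h * moment (s - 1) t\<bar> / \<bar>h\<bar>"
      by (simp add: abs_divide)
    also have "\<dots> \<le> h\<^sup>2 * C / \<bar>h\<bar>"
      unfolding C_def using that by (intro divide_right_mono moment_Taylor_bound t) auto
    also have "\<dots> = C * \<bar>h\<bar>"
      using that by (simp add: power2_eq_square abs_mult_self_eq [symmetric, of h] del: abs_mult_self_eq)
    finally show ?thesis .
  qed
  have "((\<lambda>h. (moment s (t + h) - moment s t) / h - - moment (s - 1) t) \<longlongrightarrow> 0) (at 0)"
  proof (rule Lim_null_comparison)
    show "\<forall>\<^sub>F h in at 0. norm ((moment s (t + h) - moment s t) / h - - moment (s - 1) t) \<le> C * \<bar>h\<bar>"
      unfolding eventually_at using bound t by (intro exI[of _ "t / 2"]) auto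
    show "((\<lambda>h. C * \<bar>h\<bar>) \<longlongrightarrow> 0) (at 0)"
      by (auto intro!: tendsto_eq_intros)
  qed
  then show ?thesis
    unfolding DERIV_def by (rule LIM_zero_cancel)
qed

section \<open>Integrals of polynomials against the weight\<close>

definition weighted_integral :: "real \<Rightarrow> real \<Rightarrow> real poly \<Rightarrow> real" where
  "weighted_integral \<alpha> t Q = (LBINT x:{0<..}. poly Q x * laguerre_weight \<alpha> t x)"

text \<open>The range \<open>N\<close> may exceed the degree, so that several polynomials, or one
  depending on t, share the same finite sum.\<close>

lemma weighted_integral_eq_sum:
  assumes t: "t > 0" and N: "degree Q \<le> N"
  shows "weighted_integral \<alpha> t Q = (\<Sum>k\<le>N. coeff Q k * moment (\<alpha> + real k) t)"
proof -
  have "weighted_integral \<alpha> t Q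
      = (LBINT x:{0<..}. (\<Sum>k\<le>N. coeff Q k * laguerre_weight (\<alpha> + real k) t x))"
    unfolding weighted_integral_def
  proof (rule set_lebesgue_integral_cong)
    show "\<forall>x. x \<in> {0<..} \<longrightarrow> poly Q x * laguerre_weight \<alpha> t x
        = (\<Sum>k\<le>N. coeff Q k * laguerre_weight (\<alpha> + real k) t x)"
    proof (intro allI impI)
      fix x :: real assume x: "x \<in> {0<..}"
      have "poly Q x = (\<Sum>k\<le>N. coeff Q k * x ^ k)"
        by (subst poly_as_sum_of_monoms'[OF N, symmetric]) (simp add: poly_sum poly_monom)
      then show "poly Q x * laguerre_weight \<alpha> t x
          = (\<Sum>k\<le>N. coeff Q k * laguerre_weight (\<alpha> + real k) t x)"
        using x by (simp add: sum_distrib_right mult.assoc laguerre_weight_shift)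
    qed
  qed simp
  also have "\<dots> = (\<Sum>k\<le>N. coeff Q k * moment (\<alpha> + real k) t)"
  proof -
    have "(LBINT x:{0<..}. (\<Sum>k\<le>N. coeff Q k * laguerre_weight (\<alpha> + real k) t x))
       = (\<integral>x. (\<Sum>k\<le>N. coeff Q k * (indicat_real {0<..} x * laguerre_weight (\<alpha> + real k) t x)) \<partial>lborel)"
      by (simp add: set_lebesgue_integral_def sum_distrib_left mult.left_commute)
    also have "\<dots> = (\<Sum>k\<le>N. (\<integral>x. coeff Q k * (indicat_real {0<..} x * laguerre_weight (\<alpha> + real k) t x) \<partial>lborel))"
      by (intro Bochner_Integration.integral_sum integrable_mult_right)
        (use laguerre_weight_integrable[OF t] in \<open>simp add: set_integrable_def\<close>)
    also have "\<dots> = (\<Sum>k\<le>N. coeff Q k * moment (\<alpha> + real k) t)"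
      by (simp add: moment_def set_lebesgue_integral_def)
    finally show ?thesis .
  qed
  finally show ?thesis .
qed

lemma weighted_integral_add:
  assumes "t > 0"
  shows "weighted_integral \<alpha> t (Q + R) = weighted_integral \<alpha> t Q + weighted_integral \<alpha> t R"
proof -
  define N where "N = max (degree Q) (degree R)"
  have "degree Q \<le> N" "degree R \<le> N" "degree (Q + R) \<le> N"
    by (auto simp: N_def degree_add_le_max)
  then show ?thesis
    using assms by (simp add: weighted_integral_eq_sum sum.distrib algebra_simps)
qed

lemma weighted_integral_smult: "weighted_integral \<alpha> t (smult c Q) = c * weighted_integral \<alpha> t Q"
  by (simp add: weighted_integral_def mult.assoc)

lemma weighted_integral_monom:
  assumes "t > 0"
  shows "weighted_integral \<alpha> t (monom c k) = c * moment (\<alpha> + real k) t"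
proof -
  have "weighted_integral \<alpha> t (monom c k) = (\<Sum>i\<le>k. coeff (monom c k) i * moment (\<alpha> + real i) t)"
    using assms by (intro weighted_integral_eq_sum degree_monom_le)
  also have "\<dots> = (\<Sum>i\<le>k. if i = k then c * moment (\<alpha> + real i) t else 0)"
    by (intro sum.cong) auto
  finally show ?thesis by simp
qed

lemma weighted_integral_nonneg:
  assumes "\<And>x. x > 0 \<Longrightarrow> poly Q x \<ge> 0"
  shows "weighted_integral \<alpha> t Q \<ge> 0"
  unfolding weighted_integral_def set_lebesgue_integral_def
  by (intro integral_nonneg_AE) (auto simp: indicator_def assms laguerre_weight_nonneg)

lemma poly_monom_induct:
  assumes "\<And>c k. M (monom c k)" and "\<And>p q. M p \<Longrightarrow> M q \<Longrightarrow> M (p + q)"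
  shows "M (p :: 'a :: comm_monoid_add poly)"
proof -
  have "M (\<Sum>i\<le>n. monom (f i) i)" for f :: "nat \<Rightarrow> 'a" and n
    by (induction n) (simp_all add: assms)
  from this[of "coeff p" "degree p"] show ?thesis
    by (simp add: poly_as_sum_of_monoms)
qed

text \<open>The integrand is the derivative of x^2 Q w, where x^2 clears the denominators of w'/w.
  On monomials this is \<open>moment_recurrence\<close>, and linearity does the rest.\<close>

lemma weighted_integral_pearson:
  assumes t: "t > 0"
  shows "weighted_integral \<alpha> t (monom 1 2 * pderiv Q + [:t, \<alpha> + 2, - 1:] * Q) = 0"
proof (induction Q rule: poly_monom_induct)
  case (1 c k)
  have "monom 1 2 * pderiv (monom c k) + [:t, \<alpha> + 2, - 1:] * monom c k
     = monom (t * c) k + monom ((\<alpha> + real k + 2) * c) (k + 1) + monom (- c) (k + 2)"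
  proof -
    have "[:t, \<alpha> + 2, - 1:] = monom t 0 + monom (\<alpha> + 2) 1 + monom (- 1) 2"
      by (simp add: monom_altdef power2_eq_square)
    moreover have "monom 1 2 * pderiv (monom c k) = monom (real k * c) (k + 1)"
      by (cases k) (simp_all add: pderiv_monom mult_monom)
    ultimately show ?thesis
      by (simp add: distrib_right mult_monom add_monom [symmetric] algebra_simps del: add_2_eq_Suc add_2_eq_Suc')
  qed
  then have "weighted_integral \<alpha> t (monom 1 2 * pderiv (monom c k) + [:t, \<alpha> + 2, - 1:] * monom c k)
      = t * c * moment (\<alpha> + real k) t + (\<alpha> + real k + 2) * c * moment (\<alpha> + real (k + 1)) t
        + - c * moment (\<alpha> + real (k + 2)) t"
    by (simp only: weighted_integral_add[OF t] weighted_integral_monom[OF t])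
  also have "\<dots> = c * ((\<alpha> + real k + 2) * moment (\<alpha> + real k + 2 - 1) t
      - moment (\<alpha> + real k + 2) t + t * moment (\<alpha> + real k + 2 - 2) t)"
    by (simp add: algebra_simps)
  also have "\<dots> = 0"
    unfolding moment_recurrence[OF t] by simp
  finally show ?case .
next
  case (2 p q)
  have "monom 1 2 * pderiv (p + q) + [:t, \<alpha> + 2, - 1:] * (p + q)
      = (monom 1 2 * pderiv p + [:t, \<alpha> + 2, - 1:] * p) + (monom 1 2 * pderiv q + [:t, \<alpha> + 2, - 1:] * q)"
    by (simp only: pderiv_add distrib_left add_ac)
  with 2 show ?case
    by (simp only: weighted_integral_add[OF t])
qed

section \<open>Monic orthogonal polynomials\<close>

text \<open>The operator x d/dx, which acts diagonally on monomials and so does not raise the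
  degree.\<close>

definition euler_deriv :: "real poly \<Rightarrow> real poly" where
  "euler_deriv Q = pCons 0 (pderiv Q)"

lemma coeff_euler_deriv: "coeff (euler_deriv Q) k = real k * coeff Q k"
  by (cases k) (simp_all add: euler_deriv_def coeff_pderiv)

lemma euler_deriv_mult: "euler_deriv (Q * R) = euler_deriv Q * R + Q * euler_deriv R"
  by (simp add: euler_deriv_def pderiv_mult algebra_simps)

text \<open>The situation at one fixed t, with integration abstracted to a linear functional. At n =
  0 the term \<open>P (n - 1)\<close> is \<open>P 0\<close> by truncation, and \<open>b_0\<close>
  removes it.\<close>

locale monic_orthogonal =
  fixes L :: "real poly \<Rightarrow> real" and P :: "nat \<Rightarrow> real poly" and a b h :: "nat \<Rightarrow> real"
  assumes L_add: "\<And>Q R. L (Q + R) = L Q + L R"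
    and L_smult: "\<And>c Q. L (smult c Q) = c * L Q"
    and degree_P: "\<And>n. degree (P n) = n"
    and lead_coeff_P: "\<And>n. lead_coeff (P n) = 1"
    and h_pos: "\<And>n. h n > 0"
    and orthogonal: "\<And>j k. L (P j * P k) = (if j = k then h j else 0)"
    and recurrence: "\<And>n. [:0, 1:] * P n = P (Suc n) + smult (a n) (P n) + smult (b n) (P (n - 1))"
    and b_0: "b 0 = 0"
begin

lemma coeff_P [simp]: "coeff (P n) n = 1"
  using lead_coeff_P[of n] by (simp add: degree_P)

lemma coeff_P_gt: "k > n \<Longrightarrow> coeff (P n) k = 0"
  by (simp add: coeff_eq_0 degree_P)

lemma L_0 [simp]: "L 0 = 0"
  using L_smult[of 0 0] by simp

lemma L_diff: "L (Q - R) = L Q - L R"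
  using L_add[of "Q - R" R] by simp

text \<open>Subtracting a multiple of \<open>P m\<close> removes the top coefficient of
  \<open>Q\<close>, and induction on the length continues. Vanishing coefficients instead of a
  degree bound let the induction start at \<open>Q = 0\<close>.\<close>

lemma L_mult_P_lower:
  "(\<And>k. k \<ge> m \<Longrightarrow> coeff Q k = 0) \<Longrightarrow> m \<le> n \<Longrightarrow> L (Q * P n) = 0"
proof (induction m arbitrary: Q)
  case 0
  then have "Q = 0"
    by (intro poly_eqI) simp
  then show ?case by simp
next
  case (Suc m)
  define R where "R = Q - smult (coeff Q m) (P m)"
  have "coeff R k = 0" if "k \<ge> m" for k
    using that Suc.prems(1)[of k] by (cases "k = m") (auto simp: R_def coeff_P_gt)
  then have "L (R * P n) = 0"
    using Suc.prems(2) by (intro Suc.IH) auto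
  moreover have "Q * P n = R * P n + smult (coeff Q m) (P m * P n)"
    by (simp add: R_def algebra_simps)
  ultimately show ?case
    using Suc.prems(2) by (simp add: L_add L_smult orthogonal)
qed

lemma L_mult_P:
  assumes "\<And>k. k > n \<Longrightarrow> coeff Q k = 0"
  shows "L (Q * P n) = coeff Q n * h n"
proof -
  define R where "R = Q - smult (coeff Q n) (P n)"
  have "coeff R k = 0" if "k \<ge> n" for k
    using that assms[of k] by (cases "k = n") (auto simp: R_def coeff_P_gt)
  then have "L (R * P n) = 0"
    by (intro L_mult_P_lower) auto
  moreover have "Q * P n = R * P n + smult (coeff Q n) (P n * P n)"
    by (simp add: R_def algebra_simps)
  ultimately show ?thesis
    by (simp add: L_add L_smult orthogonal)
qed

text \<open>Comparing coefficients in the recurrence, each step subtracts \<open>a n\<close>; the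
  term with \<open>b n\<close> has too low a degree to contribute.\<close>

lemma subleading_coeff: "coeff (P (Suc n)) n = - (\<Sum>j<Suc n. a j)"
proof (induction n)
  case 0
  show ?case
    using arg_cong[OF recurrence[of 0], of "\<lambda>p. coeff p 0"] coeff_P[of 0] by (simp add: b_0)
next
  case (Suc n)
  show ?case
    using arg_cong[OF recurrence[of "Suc n"], of "\<lambda>p. coeff p (Suc n)"] Suc.IH
    by (simp add: coeff_P_gt)
qed

text \<open>Removing the top term with \<open>P (Suc n)\<close> alters the coefficient at n by the
  subleading one, which is how sums of the \<open>a j\<close> enter the string equation.\<close>

lemma L_mult_P_Suc:
  assumes "\<And>k. k > Suc n \<Longrightarrow> coeff Q k = 0"
  shows "L (Q * P n) = (coeff Q n + coeff Q (Suc n) * (\<Sum>j<Suc n. a j)) * h n"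
proof -
  define R where "R = Q - smult (coeff Q (Suc n)) (P (Suc n))"
  have "coeff R k = 0" if "k > n" for k
    using that assms[of k] by (cases "k = Suc n") (auto simp: R_def coeff_P_gt)
  then have "L (R * P n) = coeff R n * h n"
    by (rule L_mult_P)
  moreover have "Q * P n = R * P n + smult (coeff Q (Suc n)) (P (Suc n) * P n)"
    by (simp add: R_def algebra_simps)
  ultimately have "L (Q * P n) = coeff R n * h n"
    by (simp add: L_add L_smult orthogonal)
  also have "coeff R n = coeff Q n + coeff Q (Suc n) * (\<Sum>j<Suc n. a j)"
    by (simp add: R_def subleading_coeff del: sum.lessThan_Suc)
  finally show ?thesis .
qed

lemma L_X_P_P: "L ([:0, 1:] * (P n * P n)) = a n * h n"
proof -
  have "L ([:0, 1:] * P n * P n) = a n * h n"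
    unfolding recurrence by (cases n) (simp_all add: distrib_right L_add L_smult orthogonal b_0)
  then show ?thesis by (simp only: mult.assoc)
qed

lemma L_X_P_Suc_P: "L ([:0, 1:] * (P (Suc n) * P n)) = h (Suc n)"
proof -
  have "[:0, 1:] * (P (Suc n) * P n) = ([:0, 1:] * P n) * P (Suc n)"
    by (simp only: mult_ac)
  also have "L \<dots> = h (Suc n)"
    unfolding recurrence by (simp add: distrib_right L_add L_smult orthogonal)
  finally show ?thesis .
qed

text \<open>\<open>L\<close> of x times \<open>P (Suc n) * P n\<close> is evaluated twice, by
  applying the recurrence to either factor.\<close>

lemma h_Suc: "h (Suc n) = b (Suc n) * h n"
proof -
  have "L ([:0, 1:] * P (Suc n) * P n) = b (Suc n) * h n"
    unfolding recurrence by (simp add: distrib_right L_add L_smult orthogonal)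
  then show ?thesis
    using L_X_P_Suc_P[of n] by (simp only: mult.assoc)
qed

lemma L_X_P_X_P: "L (([:0, 1:] * P n) * ([:0, 1:] * P n)) = h n * (b (Suc n) + (a n)\<^sup>2 + b n)"
proof -
  have "L (([:0, 1:] * P n) * ([:0, 1:] * P n)) = h (Suc n) + (a n)\<^sup>2 * h n + (b n)\<^sup>2 * h (n - 1)"
    unfolding recurrence
    by (cases n) (simp_all add: distrib_right distrib_left L_add L_smult orthogonal b_0 power2_eq_square)
  moreover have "(b n)\<^sup>2 * h (n - 1) = b n * h n"
    by (cases n) (simp_all add: b_0 h_Suc power2_eq_square)
  ultimately show ?thesis
    by (simp add: h_Suc algebra_simps)
qed

text \<open>The Pearson identity is evaluated at the square of \<open>P n\<close>. Each summand
  reduces to a multiple of \<open>h n\<close>, which is then cancelled.\<close>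

lemma string_equation:
  assumes pearson: "L (monom 1 2 * pderiv (P n * P n) + [:t, c, - 1:] * (P n * P n)) = 0"
  shows "(a n)\<^sup>2 + b n + b (Suc n) = t + 2 * (\<Sum>j<n. a j) + (2 * real n + c) * a n"
proof -
  define T where "T = pCons 0 (euler_deriv (P n))"
  \<comment> \<open>For n = 0 both sides are 0, as the sum is empty; otherwise this is the
    subleading coefficient of \<open>P n\<close> scaled by n - 1.\<close>
  have T_n: "coeff T n = - (real n - 1) * (\<Sum>j<n. a j)"
    using subleading_coeff[of "n - 1"]
    by (cases n) (auto simp: T_def coeff_euler_deriv simp del: sum.lessThan_Suc)
  have T_Suc: "coeff T (Suc n) = real n"
    by (simp add: T_def coeff_euler_deriv)
  have "coeff T k = 0" if "k > Suc n" for k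
    using that by (cases k) (simp_all add: T_def coeff_euler_deriv coeff_P_gt)
  then have "L (T * P n) = (coeff T n + coeff T (Suc n) * (\<Sum>j<Suc n. a j)) * h n"
    by (rule L_mult_P_Suc)
  also have "coeff T n + coeff T (Suc n) * (\<Sum>j<Suc n. a j) = (\<Sum>j<n. a j) + real n * a n"
    unfolding T_n T_Suc by (simp add: algebra_simps)
  finally have T: "L (T * P n) = ((\<Sum>j<n. a j) + real n * a n) * h n" .
  have "monom 1 2 * pderiv (P n * P n) + [:t, c, - 1:] * (P n * P n)
      = smult 2 (T * P n) + smult t (P n * P n) + smult c ([:0, 1:] * (P n * P n))
        - ([:0, 1:] * P n) * ([:0, 1:] * P n)"
  proof -
    define X :: "real poly" where "X = [:0, 1:]"
    have X: "monom 1 2 = X * X" "[:t, c, - 1:] = [:t:] + smult c X - X * X" "T = X * X * pderiv (P n)"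
      by (simp_all add: X_def T_def euler_deriv_def numeral_2_eq_2 monom_Suc monom_0)
    have two: "smult 2 Q = Q + Q" for Q :: "real poly"
      using smult_add_left[of 1 1 Q] by simp
    show ?thesis
      unfolding pderiv_mult X_def [symmetric] X two by (simp add: algebra_simps)
  qed
  then have "2 * (((\<Sum>j<n. a j) + real n * a n) * h n) + t * h n + c * (a n * h n)
      - h n * (b (Suc n) + (a n)\<^sup>2 + b n) = 0"
    using pearson by (simp only: L_add L_diff L_smult T L_X_P_P L_X_P_X_P orthogonal simp_thms if_True)
  then have "h n * (2 * ((\<Sum>j<n. a j) + real n * a n) + t + c * a n - (b (Suc n) + (a n)\<^sup>2 + b n)) = 0"
    by (simp add: algebra_simps)
  then have "2 * ((\<Sum>j<n. a j) + real n * a n) + t + c * a n - (b (Suc n) + (a n)\<^sup>2 + b n) = 0"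
    using h_pos[of n] by (metis less_irrefl mult_eq_0_iff)
  then show ?thesis
    by (simp add: algebra_simps)
qed

end

section \<open>Dependence on \<open>t\<close>\<close>

text \<open>Differentiation in the parameter is taken coefficientwise, so no topology on polynomials
  is required.\<close>

definition has_coeff_deriv :: "(real \<Rightarrow> real poly) \<Rightarrow> real poly \<Rightarrow> real \<Rightarrow> bool" where
  "has_coeff_deriv Q D t \<longleftrightarrow> (\<forall>k. ((\<lambda>s. coeff (Q s) k) has_real_derivative coeff D k) (at t))"

lemma has_coeff_deriv_mult:
  assumes "has_coeff_deriv Q D t" "has_coeff_deriv R E t"
  shows "has_coeff_deriv (\<lambda>s. Q s * R s) (D * R t + Q t * E) t"
  unfolding has_coeff_deriv_def
proof
  fix k
  have "((\<lambda>s. \<Sum>i\<le>k. coeff (Q s) i * coeff (R s) (k - i)) has_real_derivative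
      (\<Sum>i\<le>k. coeff (Q t) i * coeff E (k - i) + coeff D i * coeff (R t) (k - i))) (at t)"
    using assms unfolding has_coeff_deriv_def by (intro DERIV_sum DERIV_mult') auto
  then show "((\<lambda>s. coeff (Q s * R s) k) has_real_derivative coeff (D * R t + Q t * E) k) (at t)"
    by (simp add: coeff_mult sum.distrib add.commute)
qed

lemma has_coeff_deriv_X_mult:
  assumes "has_coeff_deriv Q D t"
  shows "has_coeff_deriv (\<lambda>s. [:0, 1:] * Q s) ([:0, 1:] * D) t"
  unfolding has_coeff_deriv_def
proof
  fix k
  show "((\<lambda>s. coeff ([:0, 1:] * Q s) k) has_real_derivative coeff ([:0, 1:] * D) k) (at t)"
    using assms unfolding has_coeff_deriv_def by (cases k) auto
qed

text \<open>The factor \<open>- 1 / x\<close> produced by differentiating the weight in \<open>t\<close> is eliminated by integrating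
  \<open>(x Q w)'\<close>, which leaves polynomial integrands only.\<close>

lemma weighted_integral_deriv:
  assumes t: "t > 0" and Q: "has_coeff_deriv Q D t"
    and N: "\<And>s. s > 0 \<Longrightarrow> degree (Q s) \<le> N" "degree D \<le> N"
  shows "((\<lambda>s. weighted_integral \<alpha> s (Q s)) has_real_derivative
      weighted_integral \<alpha> t (smult (\<alpha> + 1) (Q t) + euler_deriv (Q t) + smult (- 1) ([:0, 1:] * Q t)) / t
      + weighted_integral \<alpha> t D) (at t)"
    (is "(_ has_real_derivative ?d) _")
proof (rule has_field_derivative_transform_within_open)
  define m where "m k = moment (\<alpha> + real k) t" for k
  \<comment> \<open>The moment lowered by differentiation has exponent \<alpha> - 1 for k = 0 and is
    then no integral of a polynomial. The recurrence re-expresses it by moments that are, at the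
    cost of dividing by t.\<close>
  have recurrence: "- moment (\<alpha> + real k - 1) t = ((\<alpha> + 1 + real k) * m k - m (Suc k)) / t" for k
    using moment_recurrence[OF t, of "\<alpha> + real k + 1"] t
    by (simp add: m_def field_simps)
  have "degree (euler_deriv (Q t)) \<le> N"
    using N(1)[OF t] by (intro degree_le) (auto simp: coeff_euler_deriv coeff_eq_0)
  then have euler: "weighted_integral \<alpha> t (euler_deriv (Q t)) = (\<Sum>k\<le>N. real k * coeff (Q t) k * m k)"
    using t by (simp add: weighted_integral_eq_sum coeff_euler_deriv m_def)
  have "degree ([:0, 1:] * Q t) \<le> Suc N"
    using N(1)[OF t] by (intro degree_le) (auto simp: coeff_pCons coeff_eq_0 split: nat.splits)
  then have "weighted_integral \<alpha> t ([:0, 1:] * Q t) = (\<Sum>k\<le>Suc N. coeff ([:0, 1:] * Q t) k * m k)"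
    using t unfolding m_def by (intro weighted_integral_eq_sum)
  also have "\<dots> = (\<Sum>k\<le>N. coeff (Q t) k * m (Suc k))"
    by (subst sum.atMost_Suc_shift) simp
  finally have X: "weighted_integral \<alpha> t ([:0, 1:] * Q t) = (\<Sum>k\<le>N. coeff (Q t) k * m (Suc k))" .
  have "weighted_integral \<alpha> t (Q t) = (\<Sum>k\<le>N. coeff (Q t) k * m k)"
    using t N by (simp add: weighted_integral_eq_sum m_def)
  with euler X have "weighted_integral \<alpha> t
        (smult (\<alpha> + 1) (Q t) + euler_deriv (Q t) + smult (- 1) ([:0, 1:] * Q t))
      = (\<Sum>k\<le>N. coeff (Q t) k * ((\<alpha> + 1 + real k) * m k - m (Suc k)))"
    unfolding weighted_integral_add[OF t] weighted_integral_smult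
    by (simp add: sum_distrib_left sum.distrib [symmetric] sum_subtractf [symmetric] algebra_simps)
  moreover have "weighted_integral \<alpha> t D = (\<Sum>k\<le>N. coeff D k * m k)"
    using t N by (simp add: weighted_integral_eq_sum m_def)
  ultimately have d: "?d = (\<Sum>k\<le>N. coeff D k * m k + - moment (\<alpha> + real k - 1) t * coeff (Q t) k)"
    by (simp add: recurrence sum.distrib sum_divide_distrib mult.commute)
  have "((\<lambda>s. \<Sum>k\<le>N. coeff (Q s) k * moment (\<alpha> + real k) s) has_real_derivative
      (\<Sum>k\<le>N. coeff D k * m k + - moment (\<alpha> + real k - 1) t * coeff (Q t) k)) (at t)"
    unfolding m_def
    using Q unfolding has_coeff_deriv_def by (intro DERIV_sum DERIV_mult moment_deriv t) auto
  then show "((\<lambda>s. \<Sum>k\<le>N. coeff (Q s) k * moment (\<alpha> + real k) s) has_real_derivative ?d) (at t)"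
    unfolding d .
  show "open {0::real<..}" "t \<in> {0<..}"
    using t by auto
  show "(\<Sum>k\<le>N. coeff (Q s) k * moment (\<alpha> + real k) s) = weighted_integral \<alpha> s (Q s)"
    if "s \<in> {0<..}" for s
    using weighted_integral_eq_sum[of s "Q s" N \<alpha>] that N(1)[of s] by simp
qed

lemma differentiable_transform_positive:
  fixes f g :: "real \<Rightarrow> real"
  assumes "f differentiable at t" "t > 0" "\<And>s. s > 0 \<Longrightarrow> f s = g s"
  shows "g differentiable at t"
  using assms has_field_derivative_transform_within_open[of f _ t "{0<..}" g]
  by (force simp: real_differentiable_def)

text \<open>Coefficients that are constant in the parameter drop out of the derivative. For the
  monic \<open>P n\<close> this leaves a polynomial of degree below n, hence orthogonal to
  \<open>P n\<close>.\<close>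

lemma has_coeff_deriv_obtain:
  assumes "\<And>k. (\<lambda>s. coeff (Q s) k) differentiable at t" and t: "t > 0"
    and const: "\<And>k s. k \<ge> n \<Longrightarrow> s > 0 \<Longrightarrow> coeff (Q s) k = c k"
  obtains D where "has_coeff_deriv Q D t" "\<And>k. k \<ge> n \<Longrightarrow> coeff D k = 0"
proof -
  obtain d where d: "((\<lambda>s. coeff (Q s) k) has_real_derivative d k) (at t)" for k
    using assms(1) unfolding real_differentiable_def by metis
  define D where "D = (\<Sum>k<n. monom (d k) k)"
  have coeff_D: "coeff D k = (if k < n then d k else 0)" for k
    by (simp add: D_def coeff_sum)
  have "d k = 0" if "k \<ge> n" for k
  proof -
    have "((\<lambda>s. coeff (Q s) k) has_real_derivative 0) (at t)"
      by (rule has_field_derivative_transform_within_open[of "\<lambda>_. c k" _ _ "{0<..}"])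
         (use t that const in auto)
    then show ?thesis
      using d DERIV_unique by blast
  qed
  then have "has_coeff_deriv Q D t"
    using d unfolding has_coeff_deriv_def coeff_D by (metis not_less)
  then show thesis
    using that coeff_D by simp
qed

locale laguerre_orthogonal =
  fixes \<alpha> :: real and P :: "nat \<Rightarrow> real \<Rightarrow> real poly" and a b h :: "nat \<Rightarrow> real \<Rightarrow> real"
  assumes monic_orthogonal: "\<And>t. t > 0 \<Longrightarrow>
      monic_orthogonal (weighted_integral \<alpha> t) (\<lambda>n. P n t) (\<lambda>n. a n t) (\<lambda>n. b n t) (\<lambda>n. h n t)"
    and b_0: "b 0 = (\<lambda>_. 0)"
begin

lemmas degree_P = monic_orthogonal.degree_P[OF monic_orthogonal]
lemmas h_pos = monic_orthogonal.h_pos[OF monic_orthogonal]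
lemmas orthogonal = monic_orthogonal.orthogonal[OF monic_orthogonal]
lemmas h_Suc = monic_orthogonal.h_Suc[OF monic_orthogonal]

section \<open>Differentiability of the orthogonal polynomials in t\<close>

lemma degree_P_mult: "s > 0 \<Longrightarrow> degree (P n s * P m s) \<le> n + m"
  using degree_mult_le[of "P n s" "P m s"] by (simp add: degree_P)

lemma P_coeff_deriv:
  assumes t: "t > 0" and diff: "\<And>k. (\<lambda>s. coeff (P n s) k) differentiable at t"
  obtains D where "has_coeff_deriv (P n) D t" "\<And>k. k \<ge> n \<Longrightarrow> coeff D k = 0"
proof (rule has_coeff_deriv_obtain[OF diff t, of n])
  show "coeff (P n s) k = (if k = n then 1 else 0)" if "k \<ge> n" "s > 0" for k s
    using that monic_orthogonal.coeff_P[OF monic_orthogonal, of s n]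
      monic_orthogonal.coeff_P_gt[OF monic_orthogonal, of s n k] by auto
qed (use that in blast)

text \<open>In the derivative of the squared norm the terms with the derivative of
  \<open>P n\<close> vanish by orthogonality; the Euler operator contributes 2n and multiplication
  by -x contributes \<open>- a n t\<close>. Differentiability is assumed here because its inductive
  proof uses this lemma.\<close>

lemma h_deriv_aux:
  assumes t: "t > 0" and diff: "\<And>k. (\<lambda>s. coeff (P n s) k) differentiable at t"
  shows "(h n has_real_derivative h n t * (\<alpha> + 1 + 2 * real n - a n t) / t) (at t)"
proof -
  interpret monic_orthogonal "weighted_integral \<alpha> t" "\<lambda>n. P n t" "\<lambda>n. a n t" "\<lambda>n. b n t" "\<lambda>n. h n t"
    using t by (rule monic_orthogonal)
  obtain D where D: "has_coeff_deriv (P n) D t" "\<And>k. k \<ge> n \<Longrightarrow> coeff D k = 0"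
    using P_coeff_deriv[OF t diff] by blast
  have "degree D \<le> n"
    using D(2) by (intro degree_le) simp
  then have deg: "degree (D * P n t + P n t * D) \<le> n + n"
    using degree_mult_le[of D "P n t"] by (intro degree_add_le) (auto simp: degree_P mult.commute)
  have "weighted_integral \<alpha> t (D * P n t) = 0"
    using D(2) by (intro L_mult_P_lower[of n]) auto
  then have zero: "weighted_integral \<alpha> t (D * P n t + P n t * D) = 0"
    by (simp only: L_add mult.commute[of "P n t" D])
  have "weighted_integral \<alpha> t (euler_deriv (P n t) * P n t) = real n * h n t"
    by (subst L_mult_P) (auto simp: coeff_euler_deriv coeff_P_gt)
  then have euler: "weighted_integral \<alpha> t (euler_deriv (P n t * P n t)) = 2 * real n * h n t"
    by (simp only: euler_deriv_mult L_add mult.commute[of "P n t" "euler_deriv (P n t)"])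
  have "((\<lambda>s. weighted_integral \<alpha> s (P n s * P n s)) has_real_derivative
      h n t * (\<alpha> + 1 + 2 * real n - a n t) / t) (at t)"
    using weighted_integral_deriv[OF t has_coeff_deriv_mult[OF D(1) D(1)] degree_P_mult deg, of \<alpha>]
    unfolding zero unfolding L_add L_smult euler L_X_P_P orthogonal by (simp add: algebra_simps)
  then show ?thesis
    by (rule has_field_derivative_transform_within_open[of _ _ _ "{0<..}"])
       (use t laguerre_orthogonal.orthogonal[OF laguerre_orthogonal_axioms] in auto)
qed

lemma a_differentiable_aux:
  assumes t: "t > 0" and diff: "\<And>k. (\<lambda>s. coeff (P n s) k) differentiable at t"
  shows "a n differentiable at t"
proof -
  obtain D where D: "has_coeff_deriv (P n) D t" "\<And>k. k \<ge> n \<Longrightarrow> coeff D k = 0"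
    using P_coeff_deriv[OF t diff] by blast
  define E where "E = [:0, 1:] * (D * P n t + P n t * D)"
  have "((\<lambda>s. weighted_integral \<alpha> s ([:0, 1:] * (P n s * P n s))) has_real_derivative
      weighted_integral \<alpha> t (smult (\<alpha> + 1) ([:0, 1:] * (P n t * P n t)) + euler_deriv ([:0, 1:] * (P n t * P n t))
        + smult (- 1) ([:0, 1:] * ([:0, 1:] * (P n t * P n t)))) / t
      + weighted_integral \<alpha> t E) (at t)"
  proof (rule weighted_integral_deriv[OF t])
    show "has_coeff_deriv (\<lambda>s. [:0, 1:] * (P n s * P n s)) E t"
      unfolding E_def by (intro has_coeff_deriv_X_mult has_coeff_deriv_mult D)
    \<comment> \<open>Any degree bound common to all s > 0 and to \<open>E\<close> will do, since
      only the existence of the derivative matters.\<close>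
    show "degree ([:0, 1:] * (P n s * P n s)) \<le> max (1 + (n + n)) (degree E)" if "s > 0" for s
      using degree_mult_le[of "[:0, 1:]" "P n s * P n s"] degree_P_mult[OF that, of n n] by simp
  qed simp
  then have "(\<lambda>s. weighted_integral \<alpha> s ([:0, 1:] * (P n s * P n s))) differentiable at t"
    unfolding real_differentiable_def by blast
  moreover have "h n differentiable at t"
    using h_deriv_aux[OF t diff] unfolding real_differentiable_def by blast
  ultimately have "(\<lambda>s. weighted_integral \<alpha> s ([:0, 1:] * (P n s * P n s)) / h n s) differentiable at t"
    using h_pos[OF t, of n] by (intro differentiable_divide) auto
  then show ?thesis
  proof (rule differentiable_transform_positive[OF _ t])
    show "weighted_integral \<alpha> s ([:0, 1:] * (P n s * P n s)) / h n s = a n s" if "s > 0" for s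
      using monic_orthogonal.L_X_P_P[OF monic_orthogonal[OF that], of n] h_pos[OF that, of n] by simp
  qed
qed

text \<open>The recurrence expresses P_(m+1) by P_m, P_(m-1), \<open>a m\<close> and
  \<open>b m\<close>. The last two are quotients of integrals already known to be differentiable,
  with \<open>b m\<close> a ratio of consecutive \<open>h\<close>.\<close>

lemma coeff_P_differentiable:
  "t > 0 \<Longrightarrow> (\<lambda>s. coeff (P n s) k) differentiable at t"
proof (induction n arbitrary: k rule: less_induct)
  case (less n)
  show ?case
  proof (cases n)
    case 0
    have "(\<lambda>_. if k = 0 then 1 else 0 :: real) differentiable at t"
      by simp
    then show ?thesis
    proof (rule differentiable_transform_positive[OF _ less.prems])
      show "(if k = 0 then 1 else 0) = coeff (P n s) k" if "s > 0" for s
        using monic_orthogonal.coeff_P[OF monic_orthogonal[OF that], of 0]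
          monic_orthogonal.coeff_P_gt[OF monic_orthogonal[OF that], of 0 k] 0 by auto
    qed
  next
    case (Suc m)
    have IH: "(\<lambda>s. coeff (P j s) k) differentiable at t" if "j \<le> m" for j k
      using less.IH[of j k] less.prems that Suc by simp
    have b: "b m differentiable at t"
    proof (cases m)
      case 0
      then show ?thesis by (simp add: b_0)
    next
      case (Suc l)
      have "h m differentiable at t" "h l differentiable at t"
        using h_deriv_aux[OF less.prems IH] Suc unfolding real_differentiable_def by (meson le_refl le_SucI)+
      then have "(\<lambda>s. h m s / h l s) differentiable at t"
        using h_pos[OF less.prems, of l] by (intro differentiable_divide) auto
      then show ?thesis
      proof (rule differentiable_transform_positive[OF _ less.prems])
        show "h m s / h l s = b m s" if "s > 0" for s
          using h_Suc[OF that, of l] h_pos[OF that, of l] Suc by simp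
      qed
    qed
    have X: "(\<lambda>s. coeff ([:0, 1:] * P m s) k) differentiable at t"
      using IH[of m] by (cases k) auto
    have "(\<lambda>s. coeff ([:0, 1:] * P m s) k - a m s * coeff (P m s) k - b m s * coeff (P (m - 1) s) k)
        differentiable at t"
      by (intro differentiable_diff differentiable_mult X b IH a_differentiable_aux less.prems) auto
    then show ?thesis
    proof (rule differentiable_transform_positive[OF _ less.prems])
      show "coeff ([:0, 1:] * P m s) k - a m s * coeff (P m s) k - b m s * coeff (P (m - 1) s) k
          = coeff (P n s) k" if "s > 0" for s
        unfolding monic_orthogonal.recurrence[OF monic_orthogonal[OF that], of m] Suc by simp
    qed
  qed
qed

section \<open>The Toda equations in t\<close>

lemma h_deriv:
  "t > 0 \<Longrightarrow> (h n has_real_derivative h n t * (\<alpha> + 1 + 2 * real n - a n t) / t) (at t)"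
  by (intro h_deriv_aux coeff_P_differentiable)

text \<open>For n = m + 1 the orthogonality of \<open>P n\<close> and \<open>P m\<close> is
  differentiated. The derivative of \<open>P n\<close> enters only through its coefficient at m, and
  the coefficient of \<open>P n\<close> there is minus the sum in question.\<close>

lemma a_sum_deriv:
  assumes t: "t > 0"
  shows "((\<lambda>s. \<Sum>j<n. a j s) has_real_derivative ((\<Sum>j<n. a j t) - b n t) / t) (at t)"
proof (cases n)
  case 0
  then show ?thesis by (simp add: b_0)
next
  case (Suc m)
  interpret monic_orthogonal "weighted_integral \<alpha> t" "\<lambda>n. P n t" "\<lambda>n. a n t" "\<lambda>n. b n t" "\<lambda>n. h n t"
    using t by (rule monic_orthogonal)
  define S where "S s = (\<Sum>j<Suc m. a j s)" for s
  obtain D where D: "has_coeff_deriv (P n) D t" "\<And>k. k \<ge> n \<Longrightarrow> coeff D k = 0"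
    using P_coeff_deriv[OF t coeff_P_differentiable[OF t]] by blast
  obtain E where E: "has_coeff_deriv (P m) E t" "\<And>k. k \<ge> m \<Longrightarrow> coeff E k = 0"
    using P_coeff_deriv[OF t coeff_P_differentiable[OF t]] by blast
  have "degree D \<le> n" "degree E \<le> m"
    using D(2) E(2) by (auto intro!: degree_le)
  then have deg: "degree (D * P m t + P n t * E) \<le> n + m"
    using degree_mult_le[of D "P m t"] degree_mult_le[of "P n t" E]
    by (intro degree_add_le) (auto simp: degree_P)
  have "weighted_integral \<alpha> t (D * P m t) = coeff D m * h m t"
    using D(2) Suc by (intro L_mult_P) simp
  moreover have "weighted_integral \<alpha> t (E * P n t) = 0"
    using E(2) Suc by (intro L_mult_P_lower[of m]) auto
  ultimately have DE: "weighted_integral \<alpha> t (D * P m t + P n t * E) = coeff D m * h m t"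
    by (simp add: L_add mult.commute[of "P n t" E])
  have "weighted_integral \<alpha> t (euler_deriv (P n t) * P m t)
      = (coeff (euler_deriv (P n t)) m + coeff (euler_deriv (P n t)) (Suc m) * S t) * h m t"
    unfolding S_def using Suc by (intro L_mult_P_Suc) (simp add: coeff_euler_deriv coeff_P_gt)
  also have "\<dots> = S t * h m t"
  proof -
    have "coeff (P n t) m = - S t" "coeff (P n t) (Suc m) = 1"
      using subleading_coeff[of m] coeff_P[of n] unfolding S_def Suc by blast+
    then show ?thesis
      by (simp add: coeff_euler_deriv algebra_simps)
  qed
  finally have "weighted_integral \<alpha> t (euler_deriv (P n t) * P m t) = S t * h m t" .
  moreover have "weighted_integral \<alpha> t (euler_deriv (P m t) * P n t) = 0"
    using Suc by (intro L_mult_P_lower[of n]) (auto simp: coeff_euler_deriv coeff_P_gt)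
  ultimately have euler: "weighted_integral \<alpha> t (euler_deriv (P n t * P m t)) = S t * h m t"
    by (simp only: euler_deriv_mult L_add mult.commute[of "P n t" "euler_deriv (P m t)"] add_0_right)
  have X: "weighted_integral \<alpha> t ([:0, 1:] * (P n t * P m t)) = b n t * h m t"
    using L_X_P_Suc_P[of m] h_Suc[of m] Suc by simp
  have "((\<lambda>s. weighted_integral \<alpha> s (P n s * P m s)) has_real_derivative
      (S t * h m t - b n t * h m t) / t + coeff D m * h m t) (at t)"
    using weighted_integral_deriv[OF t has_coeff_deriv_mult[OF D(1) E(1)] degree_P_mult deg, of \<alpha>] Suc
    unfolding DE unfolding L_add L_smult euler X orthogonal by simp
  moreover have "((\<lambda>s. weighted_integral \<alpha> s (P n s * P m s)) has_real_derivative 0) (at t)"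
    by (rule has_field_derivative_transform_within_open[of "\<lambda>_. 0" _ _ "{0<..}"])
       (use t laguerre_orthogonal.orthogonal[OF laguerre_orthogonal_axioms] Suc in auto)
  ultimately have "(S t * h m t - b n t * h m t) / t + coeff D m * h m t = 0"
    by (rule DERIV_unique)
  then have "h m t * ((S t - b n t) / t + coeff D m) = 0"
    by (simp add: algebra_simps diff_divide_distrib)
  then have "- coeff D m = (S t - b n t) / t"
    using h_pos[of m] by auto
  moreover have "((\<lambda>s. - coeff (P n s) m) has_real_derivative - coeff D m) (at t)"
    using D(1) unfolding has_coeff_deriv_def by (intro DERIV_minus) auto
  ultimately have "((\<lambda>s. - coeff (P n s) m) has_real_derivative (S t - b n t) / t) (at t)"
    by simp
  then have "(S has_real_derivative (S t - b n t) / t) (at t)"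
  proof (rule has_field_derivative_transform_within_open[of _ _ _ "{0<..}"])
    show "- coeff (P n s) m = S s" if "s \<in> {0<..}" for s
      using monic_orthogonal.subleading_coeff[OF monic_orthogonal, of s m] that Suc by (simp add: S_def)
  qed (use t in auto)
  then show ?thesis
    unfolding S_def [abs_def] Suc .
qed

lemma a_deriv:
  assumes t: "t > 0"
  shows "(a n has_real_derivative (a n t + b n t - b (Suc n) t) / t) (at t)"
proof -
  have "((\<lambda>s. (\<Sum>j<Suc n. a j s) - (\<Sum>j<n. a j s)) has_real_derivative
      ((\<Sum>j<Suc n. a j t) - b (Suc n) t) / t - ((\<Sum>j<n. a j t) - b n t) / t) (at t)"
    by (intro DERIV_diff a_sum_deriv t)
  then show ?thesis
    by (simp add: diff_divide_distrib add_divide_distrib algebra_simps)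
qed

lemma b_Suc_deriv:
  assumes t: "t > 0"
  shows "(b (Suc n) has_real_derivative b (Suc n) t * (2 + a n t - a (Suc n) t) / t) (at t)"
proof -
  have "((\<lambda>s. h (Suc n) s / h n s) has_real_derivative
      (h (Suc n) t * (\<alpha> + 1 + 2 * real (Suc n) - a (Suc n) t) / t * h n t
        - h (Suc n) t * (h n t * (\<alpha> + 1 + 2 * real n - a n t) / t)) / (h n t * h n t)) (at t)"
    using h_pos[OF t, of n] by (intro DERIV_divide h_deriv t) simp
  also have "(h (Suc n) t * (\<alpha> + 1 + 2 * real (Suc n) - a (Suc n) t) / t * h n t
        - h (Suc n) t * (h n t * (\<alpha> + 1 + 2 * real n - a n t) / t)) / (h n t * h n t)
      = b (Suc n) t * (2 + a n t - a (Suc n) t) / t"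
    using t h_pos[OF t, of n] unfolding h_Suc[OF t] by (simp add: field_simps)
  finally show ?thesis
  proof (rule has_field_derivative_transform_within_open[of _ _ _ "{0<..}"])
    show "h (Suc n) s / h n s = b (Suc n) s" if "s \<in> {0<..}" for s
      using that h_Suc[of s n] h_pos[of s n] by simp
  qed (use t in auto)
qed

text \<open>The chain rule for t = r^2 turns 1/t into 2/r. Nonnegativity of \<open>a n\<close> comes
  from integrating x times a square over positive x, that of \<open>b n\<close> from the ratio of
  norms.\<close>

sublocale toda_recurrence \<alpha> "\<lambda>n r. a n (r\<^sup>2)" "\<lambda>n r. b n (r\<^sup>2)"
proof
  fix n and r :: real
  assume r: "r > 0"
  then have t: "r\<^sup>2 > 0"
    by simp
  interpret monic_orthogonal "weighted_integral \<alpha> (r\<^sup>2)" "\<lambda>n. P n (r\<^sup>2)" "\<lambda>n. a n (r\<^sup>2)"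
      "\<lambda>n. b n (r\<^sup>2)" "\<lambda>n. h n (r\<^sup>2)"
    using t by (rule monic_orthogonal)
  have square: "((\<lambda>r. r\<^sup>2) has_real_derivative 2 * r) (at r)"
    by (auto intro!: derivative_eq_intros)
  show "((\<lambda>r. a n (r\<^sup>2)) has_real_derivative 2 * (a n (r\<^sup>2) + b n (r\<^sup>2) - b (Suc n) (r\<^sup>2)) / r) (at r)"
    using DERIV_chain2[OF a_deriv[OF t] square] r
    by (simp add: power2_eq_square mult.commute)
  show "((\<lambda>r. b (Suc n) (r\<^sup>2)) has_real_derivative
      2 * (b (Suc n) (r\<^sup>2) * (2 + a n (r\<^sup>2) - a (Suc n) (r\<^sup>2))) / r) (at r)"
    using DERIV_chain2[OF b_Suc_deriv[OF t] square] r
    by (simp add: power2_eq_square mult.commute)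
  show "(a n (r\<^sup>2))\<^sup>2 + b n (r\<^sup>2) + b (Suc n) (r\<^sup>2)
      = r\<^sup>2 + 2 * (\<Sum>j<n. a j (r\<^sup>2)) + (2 * real n + 2 + \<alpha>) * a n (r\<^sup>2)"
    using string_equation[OF weighted_integral_pearson[OF t]] by (simp add: algebra_simps)
  have "a n (r\<^sup>2) * h n (r\<^sup>2) \<ge> 0"
    unfolding L_X_P_P [symmetric] by (intro weighted_integral_nonneg) simp
  then show "a n (r\<^sup>2) \<ge> 0"
    using h_pos[of n] by (simp add: zero_le_mult_iff)
  show "b n (r\<^sup>2) \<ge> 0"
  proof (cases n)
    case 0
    then show ?thesis by (simp add: b_0)
  next
    case (Suc m)
    then show ?thesis
      using h_Suc[of m] h_pos[of m] h_pos[of n] by (simp add: zero_less_mult_iff)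
  qed
qed (simp add: b_0)

end

section \<open>The asymptotic expansions\<close>

lemma bigo_sqrt_substitute:
  fixes f :: "real \<Rightarrow> real"
  assumes "(\<lambda>r. f (r\<^sup>2) - g r) \<in> O(\<lambda>r. 1 / r ^ 3)"
  shows "(\<lambda>t. f t - g (sqrt t)) \<in> O(\<lambda>t. t powr (-3/2))"
proof -
  have "(\<lambda>t. f ((sqrt t)\<^sup>2) - g (sqrt t)) \<in> O(\<lambda>t. 1 / (sqrt t) ^ 3)"
    using assms sqrt_at_top by (rule landau_o.big.compose)
  moreover have "eventually (\<lambda>t. f ((sqrt t)\<^sup>2) - g (sqrt t) = f t - g (sqrt t)) at_top"
    using eventually_ge_at_top[of 0] by eventually_elim simp
  ultimately have "(\<lambda>t. f t - g (sqrt t)) \<in> O(\<lambda>t. 1 / (sqrt t) ^ 3)"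
    by (simp only: landau_o.big.in_cong)
  moreover have "eventually (\<lambda>t. 1 / (sqrt t) ^ 3 = t powr (-3/2)) at_top"
    using eventually_gt_at_top[of 0]
  proof eventually_elim
    case (elim t)
    have "(sqrt t) ^ 3 = (t powr (1 / 2)) powr 3"
      using elim by (simp add: powr_half_sqrt powr_numeral)
    also have "\<dots> = t powr (3 / 2)"
      by (simp add: powr_powr)
    finally show ?case
      by (simp add: powr_minus_divide)
  qed
  then have "O(\<lambda>t. 1 / (sqrt t) ^ 3) = O(\<lambda>t. t powr (-3/2))"
    by (rule landau_o.big.cong)
  ultimately show ?thesis
    by simp
qed

theorem theorem5p2:
  fixes \<alpha> :: real and n :: nat
    and P :: "nat \<Rightarrow> real \<Rightarrow> real poly"
    and a b :: "nat \<Rightarrow> real \<Rightarrow> real"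
  assumes "\<alpha> > -1" and "n \<ge> 1"
    and "\<And>t. t \<ge> 0 \<Longrightarrow> monic_orthogonal_polys (laguerre_weight \<alpha> t) (\<lambda>k. P k t)"
    and "\<And>t. t \<ge> 0 \<Longrightarrow> recurrence_coeffs (\<lambda>k. P k t) (\<lambda>k. a k t) (\<lambda>k. b k t)"
  shows "(\<lambda>t. a n t -
            (sqrt t
             + (2 * \<alpha> + 3 * (2 * real n + 1)) / 4
             + (2 * \<alpha> + 2 * real n + 1) * (2 * \<alpha> + 6 * real n + 3) / (32 * sqrt t)
             - (2 * \<alpha> + 2 * real n + 1)
                 * (\<alpha> * (4 * real n + 2) + 8 * (real n)^2 + 8 * real n + 3) / (64 * t)))
           \<in> O[at_top](\<lambda>t. t powr (-3/2))
       \<and> (\<lambda>t. b n t -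
            (real n * sqrt t / 2
             + (2 * \<alpha> * real n + 3 * (real n)^2) / 4
             + 3 * real n * (2 * \<alpha> + 2 * real n + 1) * (2 * \<alpha> + 2 * real n - 1) / (64 * sqrt t)
             - (real n)^2 * (2 * \<alpha> + 2 * real n + 1) * (2 * \<alpha> + 2 * real n - 1) / (32 * t)))
           \<in> O[at_top](\<lambda>t. t powr (-3/2))"
proof -
  \<comment> \<open>The hypotheses leave \<open>b 0\<close> arbitrary while the locale fixes it to
    0; for n \<ge> 1 the two sequences agree.\<close>
  define b' where "b' k = (if k = 0 then (\<lambda>_. 0) else b k)" for k
  \<comment> \<open>The hypothesis provides norms only existentially and separately for each t, so
    they are recovered as one explicit function of t.\<close>
  define h where "h k t = weighted_integral \<alpha> t (P k t * P k t)" for k t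
  interpret laguerre_orthogonal \<alpha> P a b' h
  proof
    fix t :: real
    assume t: "t > 0"
    show "weighted_integral \<alpha> t (Q + R) = weighted_integral \<alpha> t Q + weighted_integral \<alpha> t R" for Q R
      using t by (rule weighted_integral_add)
    show "weighted_integral \<alpha> t (smult c Q) = c * weighted_integral \<alpha> t Q" for c Q
      by (rule weighted_integral_smult)
    have mops: "monic_orthogonal_polys (laguerre_weight \<alpha> t) (\<lambda>k. P k t)"
      using assms(3) t by simp
    then show "degree (P k t) = k" "lead_coeff (P k t) = 1" for k
      unfolding monic_orthogonal_polys_def by blast+
    obtain g where g: "\<And>j. g j > 0" "\<And>j k. (LBINT x:{0<..}. poly (P j t) x * poly (P k t) x * laguerre_weight \<alpha> t x)
        = (if j = k then g j else 0)"
      using mops unfolding monic_orthogonal_polys_def by auto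
    then have "weighted_integral \<alpha> t (P j t * P k t) = (if j = k then g j else 0)" for j k
      by (simp add: weighted_integral_def)
    with g(1) show "h k t > 0" "weighted_integral \<alpha> t (P j t * P k t) = (if j = k then h j t else 0)" for j k
      by (simp_all add: h_def)
    have "recurrence_coeffs (\<lambda>k. P k t) (\<lambda>k. a k t) (\<lambda>k. b k t)"
      using assms(4) t by simp
    then show "[:0, 1:] * P k t = P (Suc k) t + smult (a k t) (P k t) + smult (b' k t) (P (k - 1) t)" for k
      unfolding recurrence_coeffs_def b'_def by auto
  qed (simp_all add: b'_def)
  have "(\<lambda>t. a n t - alpha_approx \<alpha> n (sqrt t)) \<in> O(\<lambda>t. t powr (-3/2))"
    by (intro bigo_sqrt_substitute u_approx_bigo asymptotic_expansions)
  moreover have "(\<lambda>t. b' n t - beta_approx \<alpha> n (sqrt t)) \<in> O(\<lambda>t. t powr (-3/2))"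
    by (intro bigo_sqrt_substitute asymptotic_expansions)
  moreover have "eventually (\<lambda>t. a n t - alpha_approx \<alpha> n (sqrt t) = a n t -
            (sqrt t
             + (2 * \<alpha> + 3 * (2 * real n + 1)) / 4
             + (2 * \<alpha> + 2 * real n + 1) * (2 * \<alpha> + 6 * real n + 3) / (32 * sqrt t)
             - (2 * \<alpha> + 2 * real n + 1)
                 * (\<alpha> * (4 * real n + 2) + 8 * (real n)^2 + 8 * real n + 3) / (64 * t))) at_top"
    using eventually_gt_at_top[of 0]
    by eventually_elim (simp add: alpha_approx_def alpha_coeff0_def alpha_coeff1_def alpha_coeff2_def)
  moreover have "eventually (\<lambda>t. b' n t - beta_approx \<alpha> n (sqrt t) = b n t -
            (real n * sqrt t / 2
             + (2 * \<alpha> * real n + 3 * (real n)^2) / 4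
             + 3 * real n * (2 * \<alpha> + 2 * real n + 1) * (2 * \<alpha> + 2 * real n - 1) / (64 * sqrt t)
             - (real n)^2 * (2 * \<alpha> + 2 * real n + 1) * (2 * \<alpha> + 2 * real n - 1) / (32 * t))) at_top"
    using eventually_gt_at_top[of 0]
    by eventually_elim (use \<open>n \<ge> 1\<close> in \<open>simp add: b'_def beta_approx_def beta_coeff0_def beta_coeff1_def beta_coeff2_def\<close>)
  ultimately show ?thesis
    by (simp only: landau_o.big.in_cong)
qed

end
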